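(* Let $n\ge 2$, $\frac12<s<1$, let $\Omega\subset\mathbb{R}^n$ be open with $0\in\Omega$, and let $u:\mathbb{R}^n\to\mathbb{R}$ be Lipschitz continuous with constant $L>0$ and semiconcave in $\mathbb{R}^n$ with constant $C>0$. Suppose there is a constant $\eta_0>0$ such that $(1-s)\,\mathcal{D}_s u(x)\ge \eta_0$ for all $x\in\Omega$ in the viscosity sense. Let $\mu_0,\mu_1$ be the constants defined in the context. Then for every unit vector $e\in\partial B_1(0)\subset\mathbb{R}^n$, $$0<\mu_0\le -(1-s)(-\Delta)^s_e u(0)=(1-s)\int_{\mathbb{R}}\frac{u(te)-u(0)}{|t|^{1+2s}}\,dt\le\mu_1 .$$
   Context: Notation: $\delta(u,x,y)=u(x+y)+u(x-y)-2u(x)$. $A>0$ means $A$ is a symmetric positive definite $n\times n$ real matrix. $u$ is semiconcave in $\mathbb{R}^n$ with constant $C$ if it is continuous and $\delta(u,x,y)\le C|y|^2$ for all $x,y\in\mathbb{R}^n$. The one-dimensional integral is understood in the principal value sense, i.e. $-(-\Delta)^s_eu(0)=\int_{\mathbb{R}}\frac{u(te)-u(0)}{|t|^{1+2s}}\,dt:=\frac12\int_{\mathbb{R}}\frac{u(te)+u(-te)-2u(0)}{|t|^{1+2s}}\,dt$; it is the (unnormalized) one-dimensional fractional Laplacian of the restriction of $u$ to the line spanned by $e$. Operator: $$\mathcal{D}_s u(x)=\inf\Big\{\tfrac12\int_{\mathbb{R}^n}\frac{\delta(u,x,y)}{|A^{-1}y|^{n+2s}}\,dy\ \Big|\ A>0,\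 \det A=1\Big\}.$$ Viscosity sense: a function $u:\mathbb{R}^n\to\mathbb{R}$, upper semicontinuous in $\overline\Omega$, satisfies $\mathcal{D}_su\ge f$ in $\Omega$ in the viscosity sense if, whenever $x\in\Omega$, $N\subset\Omega$ is an open neighborhood of $x$, $\psi$ is $C^2$ in $\overline N$, $\psi(x)=u(x)$ and $\psi(y)>u(y)$ for every $y\in N\setminus\{x\}$, the function $v$ equal to $\psi$ in $N$ and to $u$ in $\mathbb{R}^n\setminus N$ satisfies $\mathcal{D}_sv(x)\ge f(x)$. The hypothesis is this condition with $f\equiv\eta_0/(1-s)$. Constants: $\omega_k=\mathcal{H}^{k-1}(\partial B_1^k(0))=\frac{2\pi^{k/2}}{\Gamma(k/2)}$ and $$\mu_1=\frac{1-s}{2}\int_{\mathbb{R}}\frac{\min\{2L|t|,C|t|^2\}}{|t|^{1+2s}}\,dt=\frac{L^{2-2s}}{2s-1}\Big(\frac C2\Big)^{2s-1},$$ $$C_1=\frac{\sqrt\pi\,\Gamma(\frac{n-1}{2}+s)}{\Gamma(\frac n2+s)}\cdot\frac{\mu_1\omega_{n-1}}{2},\qquad C_2=\omega_{n-1}\,\frac{\Gamma(\frac{n-1}{2})\Gamma(s+\frac12)}{2\,\Gamma(\frac n2+s)},\qquad \mu_0=C_1^{1-n}C_2^{-1}\Big(\frac{\eta_0}{2}\Big)^n.$$ *)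

theory Defs
  imports "HOL-Analysis.Analysis"
begin

definition second_difference :: "('a::real_vector \<Rightarrow> real) \<Rightarrow> 'a \<Rightarrow> 'a \<Rightarrow> real" where
  "second_difference u x y = u (x + y) + u (x - y) - 2 * u x"

definition positive_definite :: "real ^ 'n ^ 'n \<Rightarrow> bool" where
  "positive_definite A \<longleftrightarrow> transpose A = A \<and> (\<forall>x. x \<noteq> 0 \<longrightarrow> 0 < x \<bullet> (A *v x))"

definition semiconcave :: "real \<Rightarrow> ('a::euclidean_space \<Rightarrow> real) \<Rightarrow> bool" where
  "semiconcave C u \<longleftrightarrow>
     continuous_on UNIV u \<and> (\<forall>x y. second_difference u x y \<le> C * (norm y)\<^sup>2)"

(* The Lebesgue integral of a real function with values in the extended reals: positive part minus
   negative part, so that an integral diverging to plus infinity has the value \<infinity> (the Bochner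
   integral would return 0). This is needed because the test functions in the viscosity condition
   may grow arbitrarily fast on an unbounded neighbourhood; there the negative part is integrable
   whenever u is Lipschitz and 1/2 < s. The undefined form \<infinity> - \<infinity> is \<infinity> by ereal convention. *)
definition extended_integral :: "'a measure \<Rightarrow> ('a \<Rightarrow> real) \<Rightarrow> ereal" where
  "extended_integral M f =
     enn2ereal (\<integral>\<^sup>+x. ennreal (f x) \<partial>M) - enn2ereal (\<integral>\<^sup>+x. ennreal (- f x) \<partial>M)"

definition nonlocal_MA :: "real \<Rightarrow> (real ^ 'n \<Rightarrow> real) \<Rightarrow> real ^ 'n \<Rightarrow> ereal" where
  "nonlocal_MA s u x =
     (INF A \<in> {A :: real ^ 'n ^ 'n. positive_definite A \<and> det A = 1}.
        ereal (1 / 2) * extended_integral lborel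
          (\<lambda>y. second_difference u x y / norm (matrix_inv A *v y) powr (real CARD('n) + 2 * s)))"

definition upper_semicontinuous_on :: "'a::topological_space set \<Rightarrow> ('a \<Rightarrow> real) \<Rightarrow> bool" where
  "upper_semicontinuous_on S u \<longleftrightarrow>
     (\<forall>x\<in>S. \<forall>c>u x. \<forall>\<^sub>F y in at x within S. u y < c)"

(* G is the gradient and H the Hessian of f. *)
definition C2_on_open :: "(real ^ 'n) set \<Rightarrow> (real ^ 'n \<Rightarrow> real) \<Rightarrow> bool" where
  "C2_on_open U f \<longleftrightarrow> open U \<and>
     (\<exists>(G :: real ^ 'n \<Rightarrow> real ^ 'n) (H :: real ^ 'n \<Rightarrow> real ^ 'n ^ 'n).
        (\<forall>x\<in>U. (f has_derivative (\<lambda>h. G x \<bullet> h)) (at x)) \<and>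
        (\<forall>x\<in>U. (G has_derivative (\<lambda>h. H x *v h)) (at x)) \<and>
        continuous_on U H)"

(* C^2 on a closed set means C^2 on some open set containing it. *)
definition C2_on_closure :: "(real ^ 'n) set \<Rightarrow> (real ^ 'n \<Rightarrow> real) \<Rightarrow> bool" where
  "C2_on_closure N f \<longleftrightarrow> (\<exists>U. closure N \<subseteq> U \<and> C2_on_open U f)"

definition viscosity_nonlocal_MA_ge ::
    "real \<Rightarrow> (real ^ 'n) set \<Rightarrow> (real ^ 'n \<Rightarrow> real) \<Rightarrow> (real ^ 'n \<Rightarrow> real) \<Rightarrow> bool" where
  "viscosity_nonlocal_MA_ge s \<Omega> u f \<longleftrightarrow>
     upper_semicontinuous_on (closure \<Omega>) u \<and>
     (\<forall>x N \<psi>. x \<in> \<Omega> \<and> open N \<and> x \<in> N \<and> N \<subseteq> \<Omega> \<and> C2_on_closure N \<psi> \<and>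
        \<psi> x = u x \<and> (\<forall>y\<in>N - {x}. \<psi> y > u y) \<longrightarrow>
        nonlocal_MA s (\<lambda>y. if y \<in> N then \<psi> y else u y) x \<ge> ereal (f x))"

(* The symmetrized reading of a principal value integral over the line about 0. *)
definition pv_integral :: "(real \<Rightarrow> real) \<Rightarrow> real" where
  "pv_integral g = 1 / 2 * (LINT t|lborel. g t + g (- t))"

(* The operator (-\<Delta>)^s_e, without normalizing constant. *)
definition frac_laplacian_dir ::
    "real \<Rightarrow> 'a::real_vector \<Rightarrow> ('a \<Rightarrow> real) \<Rightarrow> 'a \<Rightarrow> real" where
  "frac_laplacian_dir s e u x =
     - (1 / 2 * (LINT t|lborel. second_difference u x (t *\<^sub>R e) / \<bar>t\<bar> powr (1 + 2 * s)))"

(* The surface measure of the unit sphere in k-dimensional space. *)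
definition sphere_area :: "nat \<Rightarrow> real" where
  "sphere_area k = 2 * pi powr (real k / 2) / Gamma (real k / 2)"

definition mu1 :: "real \<Rightarrow> real \<Rightarrow> real \<Rightarrow> real" where
  "mu1 s L C =
     (1 - s) / 2 * (LINT t|lborel. min (2 * L * \<bar>t\<bar>) (C * \<bar>t\<bar>\<^sup>2) / \<bar>t\<bar> powr (1 + 2 * s))"

definition C1_const :: "nat \<Rightarrow> real \<Rightarrow> real \<Rightarrow> real \<Rightarrow> real" where
  "C1_const n s L C =
     sqrt pi * Gamma ((real n - 1) / 2 + s) / Gamma (real n / 2 + s)
       * (mu1 s L C * sphere_area (n - 1) / 2)"

definition C2_const :: "nat \<Rightarrow> real \<Rightarrow> real" where
  "C2_const n s =
     sphere_area (n - 1) * (Gamma ((real n - 1) / 2) * Gamma (s + 1 / 2)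
       / (2 * Gamma (real n / 2 + s)))"

definition mu0 :: "nat \<Rightarrow> real \<Rightarrow> real \<Rightarrow> real \<Rightarrow> real \<Rightarrow> real" where
  "mu0 n s L C \<eta> =
     C1_const n s L C powi (1 - int n) * inverse (C2_const n s) * (\<eta> / 2) ^ n"

end

theory Submission
  imports Defs
begin

text \<open>
  Semiconcavity lets one touch \<open>u\<close> at the origin from above by a paraboloid, so the viscosity inequality
  passes to a genuine inequality there (\<open>viscosity_imp_integral_inequality\<close>): for every positive definite \<open>A\<close>
  of determinant 1 for which \<open>min (2 * L * norm y) (C * (norm y)\<^sup>2)\<close> is integrable against the kernel of \<open>A\<close>, half
  the integral of the second difference of \<open>u\<close> at \<open>0\<close> against that kernel is at least \<open>\<eta>\<^sub>0 / (1 - s)\<close>.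

  Take for the inverse of \<open>A\<close> the matrix that multiplies \<open>e\<close> by \<open>a\<close> and its orthogonal complement by \<open>b\<close>, where
  \<open>a * b ^ (n - 1) = 1\<close>. Write \<open>y = p + q\<close> with \<open>p\<close> parallel and \<open>q\<close> orthogonal to \<open>e\<close>. The kernel does not change when
  \<open>q\<close> is replaced by \<open>- q\<close>, and the sum of the second differences of \<open>u\<close> with increments
  \<open>p + q\<close> and \<open>p - q\<close> exceeds twice the one with increment \<open>p\<close> by at most twice the majorant \<open>min (2 * L * norm q) (C * (norm q)\<^sup>2)\<close>
  (\<open>second_difference_add_reflection_le\<close>). Integrating out \<open>q\<close> in the first term and \<open>p\<close> in the
  second one (\<open>nn_integral_kernel_axial\<close>, \<open>nn_integral_kernel_transversal\<close>) yields

  \<open>\<eta>\<^sub>0 \<le> C2 * a powr (- 2 * s) * h + C1 * b powr (- 2 * s)\<close>,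

  where \<open>h\<close> is the quantity to be estimated. The value \<open>b powr (- 2 * s) = \<eta>\<^sub>0 / (2 * C1)\<close> makes the last term equal to
  \<open>\<eta>\<^sub>0 / 2\<close>, and solving for \<open>h\<close> gives the constant \<^const>\<open>mu0\<close>. The upper bound is the integral of the majorant.

  The second difference along \<open>e\<close> is bounded from above only, and its integrability is part of the claim. Therefore
  the argument runs with integrals of nonnegative functions, the positive and negative parts being kept on
  opposite sides of each inequality.
\<close>

section \<open>Polar coordinates and rotation invariance\<close>

text \<open>
  Both sides integrate \<open>F\<close> against the image of \<open>M\<close> under \<open>N\<close>, and that image is determined by the
  masses of the half-lines. With \<open>N\<close> the Euclidean norm this is integration in polar coordinates;
  with \<open>N\<close> a power of \<open>\<bar>x\<bar>\<close> on the line it is a change of variables.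
\<close>
lemma nn_integral_comp_power_law:
  fixes N :: "'a \<Rightarrow> real" and F :: "real \<Rightarrow> ennreal"
  assumes N [measurable]: "N \<in> borel_measurable M" and F [measurable]: "F \<in> borel_measurable borel"
    and N_nonneg: "\<And>x. x \<in> space M \<Longrightarrow> 0 \<le> N x"
    and V: "0 < V" and \<alpha>: "0 < \<alpha>"
    and power_law: "\<And>r. 0 < r \<Longrightarrow> emeasure M {x \<in> space M. N x \<le> r} = ennreal (V * r powr \<alpha>)"
  shows "(\<integral>\<^sup>+x. F (N x) \<partial>M) =
    (\<integral>\<^sup>+r\<in>{0<..}. F r * ennreal (V * \<alpha> * r powr (\<alpha> - 1)) \<partial>lborel)"
proof -
  define w :: "real \<Rightarrow> ennreal"
    where "w r = ennreal (V * \<alpha> * r powr (\<alpha> - 1)) * indicator {0<..} r" for r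
  have w [measurable]: "w \<in> borel_measurable borel"
    unfolding w_def by measurable
  \<comment> \<open>The level set of \<open>0\<close> lies in all the small sublevel sets, so it is a null set.\<close>
  have sub: "emeasure M {x \<in> space M. N x \<le> r} = ennreal (V * max 0 r powr \<alpha>)" for r
  proof (cases "0 < r")
    case True
    then show ?thesis using power_law by (simp add: max_def)
  next
    case False
    have "emeasure M {x \<in> space M. N x \<le> r} \<le> 0 + ennreal e" if "0 < e" for e
    proof -
      define d where "d = (e / V) powr (1 / \<alpha>)"
      have d: "0 < d" "V * d powr \<alpha> = e"
        using that V \<alpha> by (auto simp: d_def powr_powr)
      have "emeasure M {x \<in> space M. N x \<le> r} \<le> emeasure M {x \<in> space M. N x \<le> d}"
        using False d(1) by (intro emeasure_mono) auto
      also have "\<dots> = ennreal e" using power_law[OF d(1)] d(2) by simp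
      finally show ?thesis by simp
    qed
    then have "emeasure M {x \<in> space M. N x \<le> r} \<le> 0"
      by (rule ennreal_le_epsilon)
    then show ?thesis using False \<alpha> by (simp add: max_def)
  qed
  have "distr M borel N = density lborel w"
  proof (rule measure_eqI_generator_eq[where E="range (\<lambda>a. {..a})" and \<Omega>=UNIV and A="\<lambda>i. {..real i}"])
    show "Int_stable (range (\<lambda>a::real. {..a}))"
      by (auto simp: Int_stable_def)
    fix X :: "real set" assume "X \<in> range (\<lambda>a. {..a})"
    then obtain r where X: "X = {..r}" by auto
    have "N -` X \<inter> space M = {x \<in> space M. N x \<le> r}" by (auto simp: X)
    then have "emeasure (distr M borel N) X = ennreal (V * max 0 r powr \<alpha>)"
      using sub[of r] by (simp add: emeasure_distr X)
    also have "\<dots> = emeasure (density lborel w) X"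
    proof -
      have "((\<lambda>x. V * \<alpha> * x powr (\<alpha> - 1)) has_integral
          (V * \<alpha> * (max 0 r powr (\<alpha> - 1 + 1) / (\<alpha> - 1 + 1)))) {0..max 0 r}"
        using \<alpha> by (intro has_integral_mult_right has_integral_powr_from_0) auto
      then have *: "((\<lambda>x. V * \<alpha> * x powr (\<alpha> - 1)) has_integral
          (V * max 0 r powr \<alpha>)) {0..max 0 r}"
        using \<alpha> by simp
      have "emeasure (density lborel w) X = (\<integral>\<^sup>+x. w x * indicator X x \<partial>lborel)"
        by (simp add: emeasure_density X)
      also have "\<dots> = (\<integral>\<^sup>+x. ennreal (V * \<alpha> * x powr (\<alpha> - 1)) * indicator {0..max 0 r} x \<partial>lborel)"
        by (intro nn_integral_cong) (auto simp: w_def X indicator_def)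
      also have "\<dots> = ennreal (V * max 0 r powr \<alpha>)"
        using V \<alpha> by (intro nn_integral_has_integral_lebesgue'[OF _ *]) auto
      finally show ?thesis ..
    qed
    finally show "emeasure (distr M borel N) X = emeasure (density lborel w) X" .
  next
    show "sets (distr M borel N) = sigma_sets UNIV (range (\<lambda>a. {..a}))"
      by (subst sets_distr, subst borel_eq_atMost) simp
    show "sets (density lborel w) = sigma_sets UNIV (range (\<lambda>a. {..a}))"
      by (simp, subst borel_eq_atMost) simp
    show "(\<Union>i. {..real i}) = UNIV"
      using real_arch_simple by auto
    fix i
    have "N -` {..real i} \<inter> space M = {x \<in> space M. N x \<le> real i}" by auto
    then show "emeasure (distr M borel N) {..real i} \<noteq> \<infinity>"
      using sub[of "real i"] by (simp add: emeasure_distr)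
  qed auto
  moreover have "(\<integral>\<^sup>+x. F (N x) \<partial>M) = (\<integral>\<^sup>+r. F r \<partial>distr M borel N)"
    by (simp add: nn_integral_distr)
  ultimately have "(\<integral>\<^sup>+x. F (N x) \<partial>M) = (\<integral>\<^sup>+r. F r \<partial>density lborel w)"
    by simp
  also have "\<dots> = (\<integral>\<^sup>+r\<in>{0<..}. F r * ennreal (V * \<alpha> * r powr (\<alpha> - 1)) \<partial>lborel)"
    by (subst nn_integral_density) (auto simp: w_def mult_ac)
  finally show ?thesis .
qed

lemma nn_integral_lborel_translate:
  fixes f :: "'a::euclidean_space \<Rightarrow> ennreal"
  assumes [measurable]: "f \<in> borel_measurable borel"
  shows "(\<integral>\<^sup>+x. f (c + x) \<partial>lborel) = (\<integral>\<^sup>+x. f x \<partial>lborel)"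
proof -
  have "(\<integral>\<^sup>+x. f x \<partial>lborel) = (\<integral>\<^sup>+x. f x \<partial>distr lborel borel ((+) c))"
    by (simp add: lborel_distr_plus)
  then show ?thesis by (simp add: nn_integral_distr)
qed

text \<open>
  Let \<open>B\<close> be the unit ball. The double integral of \<open>f x\<close> over the pairs \<open>(x, y)\<close> with \<open>x - Q y \<in> B\<close>
  equals the left- or the right-hand side times the volume of \<open>B\<close>, depending on which
  variable is integrated first: the \<open>y\<close> with \<open>x - Q y \<in> B\<close> form a unit ball because \<open>Q\<close> preserves the
  norm, and for the other order one translates by \<open>Q y\<close> and then by the preimage of a fixed vector of \<open>B\<close>.
\<close>
lemma nn_integral_lborel_orthogonal_transformation:
  fixes Q :: "'a::euclidean_space \<Rightarrow> 'a" and f :: "'a::euclidean_space \<Rightarrow> ennreal"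
  assumes Q: "orthogonal_transformation Q" and f [measurable]: "f \<in> borel_measurable borel"
  shows "(\<integral>\<^sup>+x. f (Q x) \<partial>lborel) = (\<integral>\<^sup>+x. f x \<partial>lborel)"
proof -
  define B where "B = ball (0::'a) 1"
  have B [measurable]: "B \<in> sets borel" by (simp add: B_def)
  have lin: "linear Q" using Q by (simp add: orthogonal_transformation_linear)
  have Qm [measurable]: "Q \<in> borel_measurable borel"
    using lin by (intro borel_measurable_continuous_onI linear_continuous_on linear_conv_bounded_linear[THEN iffD1])
  have surj: "surj Q" using Q by (rule orthogonal_transformation_surj)
  have "(\<integral>\<^sup>+x. f x \<partial>lborel) * emeasure lborel B =
     (\<integral>\<^sup>+x. (\<integral>\<^sup>+y. f x * indicator B (x - Q y) \<partial>lborel) \<partial>lborel)"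
  proof -
    have "(\<integral>\<^sup>+y. f x * indicator B (x - Q y) \<partial>lborel) = f x * emeasure lborel B" for x
    proof -
      obtain z where z: "x = Q z" using surj by (metis surjD)
      have "norm (x - Q y) = norm (z - y)" for y
        using orthogonal_transformation_norm[OF Q, of "z - y"] by (simp add: z linear_diff[OF lin])
      then have "indicator B (x - Q y) = (indicator (ball z 1) y :: ennreal)" for y
        by (auto simp: B_def indicator_def dist_norm norm_minus_commute)
      then show ?thesis
        by (simp add: B_def nn_integral_cmult_indicator emeasure_ball)
    qed
    then show ?thesis by (simp add: nn_integral_multc)
  qed
  also have "\<dots> = (\<integral>\<^sup>+y. (\<integral>\<^sup>+x. f x * indicator B (x - Q y) \<partial>lborel) \<partial>lborel)"
    by (rule lborel_pair.Fubini') measurable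
  also have "\<dots> = (\<integral>\<^sup>+y. (\<integral>\<^sup>+b. f (Q y + b) * indicator B b \<partial>lborel) \<partial>lborel)"
  proof (rule nn_integral_cong)
    fix y
    show "(\<integral>\<^sup>+x. f x * indicator B (x - Q y) \<partial>lborel) =
        (\<integral>\<^sup>+b. f (Q y + b) * indicator B b \<partial>lborel)"
      by (subst nn_integral_lborel_translate[symmetric, where c="Q y"]) simp_all
  qed
  also have "\<dots> = (\<integral>\<^sup>+b. (\<integral>\<^sup>+y. f (Q y + b) * indicator B b \<partial>lborel) \<partial>lborel)"
    by (rule lborel_pair.Fubini') measurable
  also have "\<dots> = (\<integral>\<^sup>+b. (\<integral>\<^sup>+y. f (Q y) \<partial>lborel) * indicator B b \<partial>lborel)"
  proof (rule nn_integral_cong)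
    fix b
    obtain z where z: "b = Q z" using surj by (metis surjD)
    have "(\<integral>\<^sup>+y. f (Q y + b) \<partial>lborel) = (\<integral>\<^sup>+y. f (Q (z + y)) \<partial>lborel)"
      by (simp add: z linear_add[OF lin] add.commute)
    also have "\<dots> = (\<integral>\<^sup>+y. f (Q y) \<partial>lborel)"
      by (rule nn_integral_lborel_translate) measurable
    finally show "(\<integral>\<^sup>+y. f (Q y + b) * indicator B b \<partial>lborel) =
        (\<integral>\<^sup>+y. f (Q y) \<partial>lborel) * indicator B b"
      by (simp add: nn_integral_multc)
  qed
  also have "\<dots> = (\<integral>\<^sup>+y. f (Q y) \<partial>lborel) * emeasure lborel B"
    by (simp add: nn_integral_cmult_indicator)
  finally show ?thesis
    by (subst (asm) (1 2) mult.commute, subst (asm) ennreal_mult_cancel_left)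
      (auto simp: B_def emeasure_ball unit_ball_vol_pos less_imp_neq[symmetric])
qed

text \<open>
  Polar coordinates in the coordinate space over a finite index set. The index set is arbitrary
  because below it is a set of basis vectors with one vector removed, for which there is no type.
\<close>
lemma nn_integral_PiM_radial:
  fixes I :: "'i set" and F :: "real \<Rightarrow> ennreal"
  assumes I: "finite I" "I \<noteq> {}" and F [measurable]: "F \<in> borel_measurable borel"
  shows "(\<integral>\<^sup>+x. F (sqrt (\<Sum>i\<in>I. (x i)\<^sup>2)) \<partial>PiM I (\<lambda>_. lborel)) =
    (\<integral>\<^sup>+r\<in>{0<..}. F r * ennreal (real (card I) * unit_ball_vol (card I) * r powr (real (card I) - 1)) \<partial>lborel)"
proof -
  have "0 < card I" using I by (simp add: card_gt_0_iff)
  then show ?thesis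
    using emeasure_cball_aux[OF I(1)] I
    by (subst nn_integral_comp_power_law[where V="unit_ball_vol (card I)" and \<alpha>="card I"])
      (auto simp: powr_realpow sum_nonneg mult_ac Int_def conj_commute intro!: nn_integral_cong)
qed

lemma nn_integral_even:
  fixes F :: "real \<Rightarrow> ennreal"
  assumes F [measurable]: "F \<in> borel_measurable borel"
  shows "(\<integral>\<^sup>+t. F \<bar>t\<bar> \<partial>lborel) = 2 * (\<integral>\<^sup>+r\<in>{0<..}. F r \<partial>lborel)"
proof -
  have "(\<integral>\<^sup>+t. F \<bar>t\<bar> \<partial>lborel) = (\<integral>\<^sup>+r\<in>{0<..}. F r * ennreal (2 * 1 * r powr (1 - 1)) \<partial>lborel)"
  proof (rule nn_integral_comp_power_law)
    fix r :: real assume "0 < r"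
    moreover have "{t. \<bar>t\<bar> \<le> r} = {-r..r}" by auto
    ultimately show "emeasure lborel {t \<in> space lborel. \<bar>t\<bar> \<le> r} = ennreal (2 * r powr 1)"
      by simp
  qed auto
  also have "\<dots> = (\<integral>\<^sup>+r. 2 * (F r * indicator {0<..} r) \<partial>lborel)"
    by (intro nn_integral_cong) (auto simp: indicator_def mult.commute)
  finally show ?thesis by (simp add: nn_integral_cmult)
qed

section \<open>Gamma and Beta integrals\<close>

lemma nn_integral_Gamma_scaled:
  assumes p: "0 < p" and l: "0 < l"
  shows "(\<integral>\<^sup>+x\<in>{0<..}. ennreal (x powr (p - 1) * exp (- (l * x))) \<partial>lborel) = ennreal (Gamma p / l powr p)"
    (is "?I = _")
proof -
  have G: "0 < Gamma p" using p by (rule Gamma_real_pos)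
  have "ennreal (Gamma p) = (\<integral>\<^sup>+t. ennreal (t powr (p - 1) / exp t) * indicator {0..} t \<partial>lborel)"
    by (rule nn_integral_has_integral_lebesgue'[OF _ Gamma_integral_real[OF p], symmetric]) auto
  also have "\<dots> = ennreal \<bar>l\<bar> * (\<integral>\<^sup>+x. ennreal ((0 + l * x) powr (p - 1) / exp (0 + l * x)) * indicator {0..} (0 + l * x) \<partial>lborel)"
    using l by (intro nn_integral_real_affine) auto
  also have "(\<integral>\<^sup>+x. ennreal ((0 + l * x) powr (p - 1) / exp (0 + l * x)) * indicator {0..} (0 + l * x) \<partial>lborel)
      = (\<integral>\<^sup>+x. ennreal (l powr (p - 1)) * (ennreal (x powr (p - 1) * exp (- (l * x))) * indicator {0<..} x) \<partial>lborel)"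
  proof (rule nn_integral_cong)
    fix x :: real
    consider "x < 0" | "x = 0" | "0 < x" by linarith
    then show "ennreal ((0 + l * x) powr (p - 1) / exp (0 + l * x)) * indicator {0..} (0 + l * x)
      = ennreal (l powr (p - 1)) * (ennreal (x powr (p - 1) * exp (- (l * x))) * indicator {0<..} x)"
      using l
      by cases (auto simp: powr_mult exp_minus divide_simps indicator_def zero_le_mult_iff ennreal_mult[symmetric] mult_ac)
  qed
  also have "\<dots> = ennreal (l powr (p - 1)) * ?I"
    by (rule nn_integral_cmult) measurable
  also have "ennreal \<bar>l\<bar> * \<dots> = ennreal (l powr p) * ?I"
    using l by (simp add: mult.assoc[symmetric] ennreal_mult[symmetric] powr_mult_base)
  finally have "ennreal (1 / l powr p) * ennreal (Gamma p) = (ennreal (1 / l powr p) * ennreal (l powr p)) * ?I"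
    by (simp add: mult.assoc)
  moreover have "ennreal (1 / l powr p) * ennreal (l powr p) = 1"
    using l by (subst ennreal_mult[symmetric]) auto
  ultimately show ?thesis
    using l G by (simp add: ennreal_mult[symmetric])
qed

text \<open>
  The substitution \<open>x = r\<^sup>2\<close> turns the integral into the Gamma integral with exponent \<open>m / 2\<close>.
\<close>
lemma nn_integral_Gaussian_moment:
  assumes m: "0 < m" and l: "0 < l"
  shows "(\<integral>\<^sup>+r\<in>{0<..}. ennreal (r powr (m - 1) * exp (- (l * r\<^sup>2))) \<partial>lborel) =
    ennreal (Gamma (m / 2) / (2 * l powr (m / 2)))"
proof -
  \<comment> \<open>The law of \<open>sqrt \<bar>x\<bar>\<close> has density \<open>4 * r\<close>; this accounts for the exponent and the \<open>4\<close>.\<close>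
  define F where "F r = ennreal (r powr (m - 2) * exp (- (l * r\<^sup>2)) / 4)" for r :: real
  have F [measurable]: "F \<in> borel_measurable borel" unfolding F_def by measurable
  have G: "0 < Gamma (m / 2)" using m by (intro Gamma_real_pos) simp
  have "(\<integral>\<^sup>+r\<in>{0<..}. ennreal (r powr (m - 1) * exp (- (l * r\<^sup>2))) \<partial>lborel)
     = (\<integral>\<^sup>+r\<in>{0<..}. F r * ennreal (2 * 2 * r powr (2 - 1)) \<partial>lborel)"
  proof (rule nn_integral_cong)
    fix r :: real
    show "ennreal (r powr (m - 1) * exp (- (l * r\<^sup>2))) * indicator {0<..} r
       = F r * ennreal (2 * 2 * r powr (2 - 1)) * indicator {0<..} r"
      using powr_mult_base[of r "m - 2"]
      by (auto simp: F_def indicator_def ennreal_mult[symmetric] mult_ac)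
  qed
  also have "\<dots> = (\<integral>\<^sup>+x. F (sqrt \<bar>x\<bar>) \<partial>lborel)"
  proof (rule nn_integral_comp_power_law[symmetric])
    fix r :: real assume r: "0 < r"
    have "{x. sqrt \<bar>x\<bar> \<le> r} = {- (r\<^sup>2)..r\<^sup>2}"
      using r by (auto simp: real_sqrt_le_iff' abs_le_iff real_le_lsqrt)
    then show "emeasure lborel {x \<in> space lborel. sqrt \<bar>x\<bar> \<le> r} = ennreal (2 * r powr 2)"
      using r by simp
  qed auto
  also have "\<dots> = 2 * (\<integral>\<^sup>+x\<in>{0<..}. F (sqrt x) \<partial>lborel)"
    by (rule nn_integral_even) measurable
  also have "\<dots> = (\<integral>\<^sup>+x. ennreal (1 / 2) * (ennreal (x powr (m / 2 - 1) * exp (- (l * x))) * indicator {0<..} x) \<partial>lborel)"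
  proof -
    have "2 * (F (sqrt x) * indicator {0<..} x) =
      ennreal (1 / 2) * (ennreal (x powr (m / 2 - 1) * exp (- (l * x))) * indicator {0<..} x)" for x :: real
    proof -
      have "2 * ennreal (x / 4) = ennreal (1 / 2) * ennreal x" if "0 \<le> x" for x
      proof -
        have "2 * ennreal (x / 4) = ennreal (2 * (x / 4))"
          using that by (subst ennreal_mult) auto
        also have "\<dots> = ennreal (1 / 2) * ennreal x"
          using that by (subst ennreal_mult[symmetric]) auto
        finally show ?thesis .
      qed
      moreover have "sqrt x powr (m - 2) = x powr (m / 2 - 1)" if "0 < x"
        using that by (simp add: powr_half_sqrt[symmetric] powr_powr diff_divide_distrib)
      ultimately show ?thesis
        by (auto simp: F_def indicator_def)
    qed
    then show ?thesis by (simp flip: nn_integral_cmult)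
  qed
  also have "\<dots> = ennreal (1 / 2) * ennreal (Gamma (m / 2) / l powr (m / 2))"
    using m l by (subst nn_integral_cmult) (auto simp: nn_integral_Gamma_scaled)
  also have "\<dots> = ennreal (Gamma (m / 2) / (2 * l powr (m / 2)))"
    using G by (subst ennreal_mult[symmetric]) auto
  finally show ?thesis .
qed

text \<open>
  Write the power \<open>- p\<close> of the quadratic form as a Gamma integral over an auxiliary variable \<open>x\<close> and exchange
  the integrations. The integral over \<open>r\<close> is then a Gaussian moment, and what remains is again a
  Gamma integral, now with exponent \<open>p - m / 2\<close>.
\<close>
lemma nn_integral_Beta_quadratic:
  assumes T: "0 < T" and b: "0 < b" and m: "0 < m" and p: "m < 2 * p"
  shows "(\<integral>\<^sup>+r\<in>{0<..}. ennreal (r powr (m - 1) / (T\<^sup>2 + b\<^sup>2 * r\<^sup>2) powr p) \<partial>lborel) =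
    ennreal (Gamma (m / 2) * Gamma (p - m / 2) / (2 * Gamma p) * (T powr (m - 2 * p) / b powr m))"
    (is "?I = ennreal ?c")
proof -
  have G: "0 < Gamma p" "0 < Gamma (m / 2)" "0 < Gamma (p - m / 2)"
    using m p by (auto intro!: Gamma_real_pos)
  have S: "0 < T\<^sup>2 + b\<^sup>2 * r\<^sup>2" for r
    using T by (intro add_pos_nonneg) auto
  have "ennreal (Gamma p) * ?I = (\<integral>\<^sup>+r. ennreal (r powr (m - 1)) * ennreal (Gamma p / (T\<^sup>2 + b\<^sup>2 * r\<^sup>2) powr p) * indicator {0<..} r \<partial>lborel)"
    using G by (subst nn_integral_cmult[symmetric])
      (auto intro!: nn_integral_cong simp: ennreal_mult[symmetric] indicator_def mult_ac)
  also have "\<dots> = (\<integral>\<^sup>+r. (\<integral>\<^sup>+x. ennreal (r powr (m - 1)) * (ennreal (x powr (p - 1) * exp (- ((T\<^sup>2 + b\<^sup>2 * r\<^sup>2) * x))) * indicator {0<..} x) * indicator {0<..} r \<partial>lborel) \<partial>lborel)"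
    using m p S
    by (subst nn_integral_Gamma_scaled[symmetric]) (auto simp: nn_integral_cmult nn_integral_multc)
  also have "\<dots> = (\<integral>\<^sup>+x. (\<integral>\<^sup>+r. ennreal (r powr (m - 1)) * (ennreal (x powr (p - 1) * exp (- ((T\<^sup>2 + b\<^sup>2 * r\<^sup>2) * x))) * indicator {0<..} x) * indicator {0<..} r \<partial>lborel) \<partial>lborel)"
    by (rule lborel_pair.Fubini') measurable
  also have "\<dots> = (\<integral>\<^sup>+x. (\<integral>\<^sup>+r. ennreal (x powr (p - 1) * exp (- (T\<^sup>2 * x))) * indicator {0<..} x * (ennreal (r powr (m - 1) * exp (- ((b\<^sup>2 * x) * r\<^sup>2))) * indicator {0<..} r) \<partial>lborel) \<partial>lborel)"
    by (intro nn_integral_cong)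
      (auto simp: indicator_def ennreal_mult[symmetric] exp_add[symmetric] algebra_simps)
  also have "\<dots> = (\<integral>\<^sup>+x. ennreal (x powr (p - 1) * exp (- (T\<^sup>2 * x))) * indicator {0<..} x * (\<integral>\<^sup>+r\<in>{0<..}. ennreal (r powr (m - 1) * exp (- ((b\<^sup>2 * x) * r\<^sup>2))) \<partial>lborel) \<partial>lborel)"
    by (simp add: nn_integral_cmult)
  also have "\<dots> = (\<integral>\<^sup>+x. ennreal (Gamma (m / 2) / (2 * b powr m)) * (ennreal (x powr ((p - m / 2) - 1) * exp (- (T\<^sup>2 * x))) * indicator {0<..} x) \<partial>lborel)"
  proof (rule nn_integral_cong)
    fix x :: real
    show "ennreal (x powr (p - 1) * exp (- (T\<^sup>2 * x))) * indicator {0<..} x * (\<integral>\<^sup>+r\<in>{0<..}. ennreal (r powr (m - 1) * exp (- ((b\<^sup>2 * x) * r\<^sup>2))) \<partial>lborel)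
      = ennreal (Gamma (m / 2) / (2 * b powr m)) * (ennreal (x powr ((p - m / 2) - 1) * exp (- (T\<^sup>2 * x))) * indicator {0<..} x)"
    proof (cases "0 < x")
      case True
      have "b\<^sup>2 = b powr 2" using b by simp
      then have "(b\<^sup>2 * x) powr (m / 2) = b powr m * x powr (m / 2)"
        using True b by (simp add: powr_mult powr_powr del: powr_numeral)
      moreover have "x powr ((p - m / 2) - 1) = x powr (p - 1) / x powr (m / 2)"
        using powr_diff[of x "p - 1" "m / 2"] by (simp add: algebra_simps)
      ultimately show ?thesis
        using True b m G nn_integral_Gaussian_moment[OF m, of "b\<^sup>2 * x"]
        by (simp add: ennreal_mult[symmetric] divide_simps mult_ac)
    qed simp
  qed
  also have "\<dots> = ennreal (Gamma (m / 2) / (2 * b powr m)) * ennreal (Gamma (p - m / 2) / (T\<^sup>2) powr (p - m / 2))"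
    using m p T by (subst nn_integral_cmult) (auto simp: nn_integral_Gamma_scaled)
  also have "\<dots> = ennreal (Gamma p) * ennreal ?c"
  proof -
    have "T\<^sup>2 = T powr 2" using T by simp
    then have "(T\<^sup>2) powr (p - m / 2) = T powr (2 * p - m)"
      by (simp add: powr_powr algebra_simps del: powr_numeral)
    moreover have "T powr (m - 2 * p) = 1 / T powr (2 * p - m)"
      by (metis minus_diff_eq powr_minus_divide)
    ultimately have "Gamma (m / 2) / (2 * b powr m) * (Gamma (p - m / 2) / (T\<^sup>2) powr (p - m / 2)) = Gamma p * ?c"
      using G(1) by simp
    moreover have "0 \<le> Gamma (m / 2) / (2 * b powr m)" "0 \<le> Gamma p"
      using G by auto
    ultimately show ?thesis by (metis ennreal_mult')
  qed
  finally show ?thesis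
    using G by (simp add: ennreal_mult_cancel_left)
qed

lemma sphere_area_eq_unit_ball_vol:
  assumes "0 < k"
  shows "real k * unit_ball_vol k = sphere_area k"
proof -
  have G: "Gamma (real k / 2 + 1) = real k / 2 * Gamma (real k / 2)"
    using assms by (intro Gamma_plus1) (auto simp: nonpos_Ints_def)
  have "0 < Gamma (real k / 2)"
    using assms by (auto intro!: Gamma_real_pos)
  then show ?thesis
    unfolding unit_ball_vol_def sphere_area_def G using assms by (simp add: field_simps)
qed

section \<open>Cylindrical coordinates\<close>

text \<open>
  A rotation takes \<open>e\<close> to a vector of the standard basis. In coordinates the integral splits off that
  variable, and the integrand depends on the others only through their Euclidean norm.
\<close>
lemma nn_integral_cylindrical:
  fixes e :: "real ^ 'n" and F :: "real \<Rightarrow> real \<Rightarrow> ennreal"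
  assumes dim: "2 \<le> CARD('n)" and e: "norm e = 1"
    and F [measurable]: "case_prod F \<in> borel_measurable (borel \<Otimes>\<^sub>M borel)"
  shows "(\<integral>\<^sup>+y. F (e \<bullet> y) (norm (y - (e \<bullet> y) *\<^sub>R e)) \<partial>lborel) =
    (\<integral>\<^sup>+t. (\<integral>\<^sup>+r\<in>{0<..}. F t r * ennreal (sphere_area (CARD('n) - 1) * r powr (real CARD('n) - 2)) \<partial>lborel) \<partial>lborel)"
proof -
  obtain k :: 'n where True by simp
  define a :: "real ^ 'n" where "a = axis k 1"
  have a: "a \<in> Basis" "norm a = 1" by (auto simp: a_def)
  let ?I = "Basis - {a} :: (real ^ 'n) set"
  have I: "finite ?I" "a \<notin> ?I" "insert a ?I = Basis" "card ?I = CARD('n) - 1"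
    using a by auto
  obtain Q where Q: "orthogonal_transformation Q" "Q a = e"
    using orthogonal_transformation_exists_1[OF a(2) e] by blast
  have lin: "linear Q" using Q by (simp add: orthogonal_transformation_linear)
  have ip: "e \<bullet> Q y = a \<bullet> y" for y
    using Q by (metis orthogonal_transformation_def)
  have nm: "norm (Q y - (a \<bullet> y) *\<^sub>R e) = norm (y - (a \<bullet> y) *\<^sub>R a)" for y
    using orthogonal_transformation_norm[OF Q(1), of "y - (a \<bullet> y) *\<^sub>R a"]
    by (simp add: linear_diff[OF lin] linear_scale[OF lin] Q(2))
  interpret product_sigma_finite "\<lambda>_. lborel :: real measure" by standard
  have "(\<integral>\<^sup>+y. F (e \<bullet> y) (norm (y - (e \<bullet> y) *\<^sub>R e)) \<partial>lborel) =
     (\<integral>\<^sup>+y. F (a \<bullet> y) (norm (y - (a \<bullet> y) *\<^sub>R a)) \<partial>lborel)"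
    by (subst nn_integral_lborel_orthogonal_transformation[OF Q(1), symmetric])
       (simp_all add: ip nm)
  also have "\<dots> = (\<integral>\<^sup>+f. F (a \<bullet> (\<Sum>b\<in>Basis. f b *\<^sub>R b)) (norm ((\<Sum>b\<in>Basis. f b *\<^sub>R b) - (a \<bullet> (\<Sum>b\<in>Basis. f b *\<^sub>R b)) *\<^sub>R a))
      \<partial>PiM Basis (\<lambda>_. lborel))"
    by (subst lborel_eq, subst nn_integral_distr) auto
  also have "\<dots> = (\<integral>\<^sup>+f. F (f a) (sqrt (\<Sum>b\<in>?I. (f b)\<^sup>2)) \<partial>PiM (insert a ?I) (\<lambda>_. lborel))"
  proof -
    have "norm ((\<Sum>b\<in>Basis. f b *\<^sub>R b) - f a *\<^sub>R a) = sqrt (\<Sum>b\<in>?I. (f b)\<^sup>2)" for f :: "real ^ 'n \<Rightarrow> real"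
    proof -
      have "(\<Sum>b\<in>Basis. f b *\<^sub>R b) = f a *\<^sub>R a + (\<Sum>b\<in>?I. f b *\<^sub>R b)"
        using a by (subst sum.remove[of _ a]) auto
      moreover have "(norm (\<Sum>b\<in>?I. f b *\<^sub>R b))\<^sup>2 = (\<Sum>b\<in>?I. (norm (f b *\<^sub>R b))\<^sup>2)"
        by (rule norm_sum_Pythagorean) (auto simp: pairwise_def orthogonal_def inner_Basis)
      ultimately show ?thesis
        by (simp add: real_sqrt_unique)
    qed
    moreover have "a \<bullet> (\<Sum>b\<in>Basis. f b *\<^sub>R b) = f a" for f :: "real ^ 'n \<Rightarrow> real"
      using a by (simp add: inner_sum_right inner_Basis if_distrib sum.delta' cong: if_cong)
    ultimately show ?thesis unfolding I(3) by simp
  qed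
  also have "\<dots> = (\<integral>\<^sup>+t. (\<integral>\<^sup>+f. F t (sqrt (\<Sum>b\<in>?I. (f b)\<^sup>2)) \<partial>PiM ?I (\<lambda>_. lborel)) \<partial>lborel)"
  proof -
    have "F ((f(a := t)) a) (sqrt (\<Sum>b\<in>?I. ((f(a := t)) b)\<^sup>2)) = F t (sqrt (\<Sum>b\<in>?I. (f b)\<^sup>2))" for f t
      using sum.cong[of ?I ?I "\<lambda>b. ((f(a := t)) b)\<^sup>2" "\<lambda>b. (f b)\<^sup>2"] by auto
    moreover have "(\<lambda>f. F (f a) (sqrt (\<Sum>b\<in>?I. (f b)\<^sup>2))) \<in> borel_measurable (PiM (insert a ?I) (\<lambda>_. lborel))"
      by measurable
    ultimately show ?thesis
      by (simp only: product_nn_integral_insert_rev[OF I(1,2)])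
  qed
  also have "\<dots> = (\<integral>\<^sup>+t. (\<integral>\<^sup>+r\<in>{0<..}. F t r * ennreal (sphere_area (CARD('n) - 1) * r powr (real CARD('n) - 2)) \<partial>lborel) \<partial>lborel)"
  proof (rule nn_integral_cong)
    fix t
    have "card ?I \<noteq> 0" using I(4) dim by simp
    then have ne: "?I \<noteq> {}" by (metis card.empty)
    have k1: "real (card ?I) * unit_ball_vol (card ?I) = sphere_area (CARD('n) - 1)"
      using sphere_area_eq_unit_ball_vol[of "card ?I"] I(4) dim by simp
    have k2: "real (card ?I) - 1 = real CARD('n) - 2"
      using I(4) dim by (simp add: of_nat_diff)
    have "F t \<in> borel_measurable borel" by measurable
    from nn_integral_PiM_radial[OF I(1) ne this]
    show "(\<integral>\<^sup>+f. F t (sqrt (\<Sum>b\<in>?I. (f b)\<^sup>2)) \<partial>PiM ?I (\<lambda>_. lborel)) = (\<integral>\<^sup>+r\<in>{0<..}. F t r * ennreal (sphere_area (CARD('n) - 1) * r powr (real CARD('n) - 2)) \<partial>lborel)"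
      unfolding k1 k2 .
  qed
  finally show ?thesis .
qed

section \<open>Semiconcave functions lie below paraboloids\<close>

text \<open>
  On a segment, subtract the chord and suppose that the maximum of the difference is positive. At the
  smallest point where the maximum is attained, midpoint convexity with a step that just stays inside the
  segment bounds the maximum by the mean of two values, the left one of which is strictly smaller.
\<close>
lemma midpoint_convex_imp_convex_on:
  fixes f :: "'a::real_normed_vector \<Rightarrow> real"
  assumes cont: "continuous_on UNIV f" and mid: "\<And>x y. 2 * f x \<le> f (x + y) + f (x - y)"
  shows "convex_on UNIV f"
proof (rule convex_onI)
  fix t :: real and x y :: 'a
  assume t: "0 < t" "t < 1"
  define g where "g a = f ((1 - a) *\<^sub>R x + a *\<^sub>R y) - ((1 - a) * f x + a * f y)" for a
  have g_cont: "continuous_on {0..1} g"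
    unfolding g_def by (intro continuous_intros continuous_on_compose2[OF cont]) auto
  have g_mid: "2 * g a \<le> g (a + h) + g (a - h)" for a h
  proof -
    have "(1 - (a + h)) *\<^sub>R x + (a + h) *\<^sub>R y = ((1 - a) *\<^sub>R x + a *\<^sub>R y) + h *\<^sub>R (y - x)"
      "(1 - (a - h)) *\<^sub>R x + (a - h) *\<^sub>R y = ((1 - a) *\<^sub>R x + a *\<^sub>R y) - h *\<^sub>R (y - x)"
      by (simp_all add: algebra_simps)
    then show ?thesis
      using mid[of "(1 - a) *\<^sub>R x + a *\<^sub>R y" "h *\<^sub>R (y - x)"]
      by (simp add: g_def algebra_simps)
  qed
  have "g t \<le> 0"
  proof (rule ccontr)
    assume pos: "\<not> g t \<le> 0"
    obtain b where b: "b \<in> {0..1}" "\<And>a. a \<in> {0..1} \<Longrightarrow> g a \<le> g b"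
      using continuous_attains_sup[OF _ _ g_cont] by fastforce
    have "compact {a \<in> {0..1}. g a = g b}"
      using continuous_closed_preimage_constant[OF g_cont, of "g b"]
      by (auto simp: compact_eq_bounded_closed intro: bounded_subset[of "{0..1}"])
    moreover have "{a \<in> {0..1}. g a = g b} \<noteq> {}" using b by auto
    ultimately obtain a where a: "a \<in> {0..1}" "g a = g b"
      and a_min: "\<And>c. c \<in> {0..1} \<Longrightarrow> g c = g b \<Longrightarrow> a \<le> c"
      using compact_attains_inf[of "{a \<in> {0..1}. g a = g b}"] by blast
    have "0 < g a" using a b(2)[of t] t pos by auto
    moreover have "g 0 = 0" "g 1 = 0" by (auto simp: g_def)
    ultimately have a01: "0 < a" "a < 1" using a(1) by (auto simp: less_le)
    \<comment> \<open>The largest step that does not leave the unit interval.\<close>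
    define h where "h = min a (1 - a)"
    have h: "0 < h" "a - h \<in> {0..1}" "a + h \<in> {0..1}" using a01 by (auto simp: h_def)
    have "g (a - h) < g b" using a_min[of "a - h"] b(2)[of "a - h"] h by force
    moreover have "g (a + h) \<le> g b" using b(2) h by blast
    ultimately show False using g_mid[of a h] a(2) by simp
  qed
  then show "f ((1 - t) *\<^sub>R x + t *\<^sub>R y) \<le> (1 - t) * f x + t * f y"
    by (simp add: g_def)
qed simp

text \<open>
  A hyperplane supporting the epigraph at \<open>(x, f x)\<close> is not vertical, since it has to pass below the
  graph over every point of the space.
\<close>
lemma convex_on_UNIV_subgradient:
  fixes f :: "'a::euclidean_space \<Rightarrow> real"
  assumes f: "convex_on UNIV f"
  obtains p where "\<And>y. f x + p \<bullet> (y - x) \<le> f y"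
proof -
  let ?S = "epigraph UNIV f"
  have S: "convex ?S" using f by (rule convex_epigraphI)
  have mem: "(y, f y + c) \<in> ?S" if "0 \<le> c" for y c
    using that by (simp add: epigraph_def)
  have not_interior: "(x, f x) \<notin> rel_interior ?S"
  proof
    assume "(x, f x) \<in> rel_interior ?S"
    moreover have above: "(x, f x + 1) \<in> ?S" using mem[of 1 x] by simp
    ultimately have "\<exists>e>1. (1 - e) *\<^sub>R (x, f x + 1) + e *\<^sub>R (x, f x) \<in> ?S"
      by (subst (asm) convex_rel_interior_iff[OF S]) blast+
    then obtain e where "1 < e" "(1 - e) *\<^sub>R (x, f x + 1) + e *\<^sub>R (x, f x) \<in> ?S"
      by blast
    then show False by (auto simp: epigraph_def algebra_simps)
  qed
  have in_closure: "(x, f x) \<in> closure ?S"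
    using mem[of 0 x] closure_subset[of ?S] by auto
  obtain q where q: "q \<noteq> 0" "\<And>z. z \<in> closure ?S \<Longrightarrow> q \<bullet> (x, f x) \<le> q \<bullet> z"
    using supporting_hyperplane_relative_frontier[OF S in_closure not_interior] by metis
  obtain p a where pa: "q = (p, a)" by (cases q)
  have supp: "p \<bullet> x + a * f x \<le> p \<bullet> y + a * (f y + c)" if "0 \<le> c" for y c
    using q(2)[of "(y, f y + c)"] mem[OF that, of y] closure_subset[of ?S] by (auto simp: pa)
  have "0 \<le> a" using supp[of 1 x] by (simp add: algebra_simps)
  moreover have "a \<noteq> 0"
  proof
    assume a: "a = 0"
    then have "p \<bullet> p \<le> 0" using supp[of 0 "x - p"] by (simp add: inner_diff_right)
    then have "p = 0" using inner_gt_zero_iff[of p] by linarith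
    then show False using q(1) a pa by (simp add: zero_prod_def)
  qed
  ultimately have a: "0 < a" by simp
  have "f x + (- (1 / a) *\<^sub>R p) \<bullet> (y - x) \<le> f y" for y
    using supp[of 0 y] a by (simp add: inner_diff_right field_simps)
  then show thesis by (rule that)
qed

text \<open>
  Subtracting \<open>u\<close> from \<open>C / 2 * (norm y)\<^sup>2\<close> gives a midpoint convex function, which has a subgradient at \<open>x\<close>.
  This is what makes the viscosity condition applicable at every single point: \<open>u\<close> can be touched from
  above there by a smooth function.
\<close>
lemma semiconcave_upper_paraboloid:
  fixes u :: "'a::euclidean_space \<Rightarrow> real"
  assumes u: "semiconcave C u"
  obtains p where "\<And>y. u y \<le> u x + p \<bullet> (y - x) + C / 2 * (norm (y - x))\<^sup>2"
proof -
  define f where "f y = C / 2 * (norm y)\<^sup>2 - u y" for y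
  have "convex_on UNIV f"
  proof (rule midpoint_convex_imp_convex_on)
    show "continuous_on UNIV f"
      using u unfolding f_def semiconcave_def by (intro continuous_intros) simp
    fix x y :: 'a
    have "(norm (x + y))\<^sup>2 + (norm (x - y))\<^sup>2 = 2 * (norm x)\<^sup>2 + 2 * (norm y)\<^sup>2"
      by (simp add: power2_norm_eq_inner inner_add inner_diff inner_commute)
    from arg_cong[OF this, of "\<lambda>z. C / 2 * z"]
    have "C / 2 * (norm (x + y))\<^sup>2 + C / 2 * (norm (x - y))\<^sup>2 = C * (norm x)\<^sup>2 + C * (norm y)\<^sup>2"
      by (simp add: distrib_left)
    moreover have "u (x + y) + u (x - y) - 2 * u x \<le> C * (norm y)\<^sup>2"
      using u by (simp add: semiconcave_def second_difference_def)
    ultimately show "2 * f x \<le> f (x + y) + f (x - y)"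
      by (simp add: f_def)
  qed
  then obtain p where p: "\<And>y. f x + p \<bullet> (y - x) \<le> f y"
    by (rule convex_on_UNIV_subgradient[of f x]) blast
  have "u y \<le> u x + (C *\<^sub>R x - p) \<bullet> (y - x) + C / 2 * (norm (y - x))\<^sup>2" for y
  proof -
    have "(norm y)\<^sup>2 = (norm x)\<^sup>2 + 2 * (x \<bullet> (y - x)) + (norm (y - x))\<^sup>2"
      by (simp add: power2_norm_eq_inner inner_diff inner_commute)
    from arg_cong[OF this, of "\<lambda>z. C / 2 * z"]
    have "C / 2 * (norm y)\<^sup>2 = C / 2 * (norm x)\<^sup>2 + C * (x \<bullet> (y - x)) + C / 2 * (norm (y - x))\<^sup>2"
      by (simp add: distrib_left)
    then show ?thesis
      using p[of y] by (simp add: f_def inner_diff_left field_simps)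
  qed
  then show thesis by (rule that)
qed

lemma C2_on_closure_paraboloid:
  fixes p x :: "real ^ 'n"
  shows "C2_on_closure N (\<lambda>y. c + p \<bullet> (y - x) + k * (norm (y - x))\<^sup>2)"
  unfolding C2_on_closure_def C2_on_open_def
proof (intro exI[of _ UNIV] exI conjI ballI)
  fix y :: "real ^ 'n"
  show "((\<lambda>y. c + p \<bullet> (y - x) + k * (norm (y - x))\<^sup>2) has_derivative
      (\<lambda>h. (p + (2 * k) *\<^sub>R (y - x)) \<bullet> h)) (at y)"
    unfolding power2_norm_eq_inner
    by (auto intro!: derivative_eq_intros simp: algebra_simps inner_commute)
  show "((\<lambda>y. p + (2 * k) *\<^sub>R (y - x)) has_derivative (\<lambda>h. mat (2 * k) *v h)) (at y)"
    by (auto intro!: derivative_eq_intros simp: vec_eq_iff matrix_vector_mult_def mat_def if_distrib if_distribR cong: if_cong)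
qed (auto)

section \<open>From viscosity to integrals\<close>

text \<open>
  The common majorant of the second differences of a function that is Lipschitz with constant \<open>L\<close> and
  semiconcave with constant \<open>C\<close>, as a function of the length of the increment. It is the numerator of the
  integral defining \<^const>\<open>mu1\<close>.
\<close>
definition sd_bound :: "real \<Rightarrow> real \<Rightarrow> real \<Rightarrow> real" where
  "sd_bound L C r = min (2 * L * r) (C * r\<^sup>2)"

lemma sd_bound_measurable [measurable]: "sd_bound L C \<in> borel_measurable borel"
  unfolding sd_bound_def[abs_def] by measurable

lemma second_difference_le_sd_bound:
  fixes u :: "'a::euclidean_space \<Rightarrow> real"
  assumes "L-lipschitz_on UNIV u" "semiconcave C u"
  shows "second_difference u x y \<le> sd_bound L C (norm y)"
proof -
  have "\<bar>u (x + y) - u x\<bar> \<le> L * norm y" "\<bar>u (x - y) - u x\<bar> \<le> L * norm y"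
    using lipschitz_onD[OF assms(1), of "x + y" x] lipschitz_onD[OF assms(1), of "x - y" x]
    by (auto simp: dist_norm)
  then have "second_difference u x y \<le> 2 * L * norm y"
    by (simp add: second_difference_def)
  moreover have "second_difference u x y \<le> C * (norm y)\<^sup>2"
    using assms(2) by (simp add: semiconcave_def)
  ultimately show ?thesis by (simp add: sd_bound_def)
qed

text \<open>
  An inequality between extended integrals in a form without subtraction. Since the positive part
  is finite, the difference of the two parts is not the undefined form, and the lower bound then excludes
  an infinite negative part.
\<close>
lemma le_half_extended_integralD:
  assumes le: "ereal c \<le> ereal (1 / 2) * extended_integral M f"
    and fin: "(\<integral>\<^sup>+x. ennreal (f x) \<partial>M) < \<infinity>" and c: "0 \<le> c"
  shows "(\<integral>\<^sup>+x. ennreal (- f x) \<partial>M) + ennreal (2 * c) \<le> (\<integral>\<^sup>+x. ennreal (f x) \<partial>M)"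
proof -
  define P Q where "P = (\<integral>\<^sup>+x. ennreal (f x) \<partial>M)" "Q = (\<integral>\<^sup>+x. ennreal (- f x) \<partial>M)"
  have le': "ereal c \<le> ereal (1 / 2) * (enn2ereal P - enn2ereal Q)"
    using le by (simp add: extended_integral_def P_Q_def)
  obtain a where a: "P = ennreal a" "0 \<le> a"
    using fin unfolding P_Q_def[symmetric] by (cases P) auto
  have "Q + ennreal (2 * c) \<le> P"
  proof (cases Q)
    case (real b)
    then have "c \<le> 1 / 2 * (a - b)"
      using le' a by (simp add: enn2ereal_ennreal)
    then show ?thesis
      using real a c by (simp flip: ennreal_plus)
  next
    case top
    then show ?thesis using le' a by (simp add: enn2ereal_ennreal)
  qed
  then show ?thesis by (simp add: P_Q_def)
qed

text \<open>
  The viscosity inequality holds classically for every matrix against whose kernel the majorant is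
  integrable. As a test function take a paraboloid that touches \<open>u\<close> from above at \<open>x\<close>, used only on
  the ball of radius \<open>r\<close>. The second difference of the resulting function is that of \<open>u\<close> for increments outside
  the ball, and inside, for small \<open>r\<close>, it is twice the majorant. As \<open>r\<close> tends to \<open>0\<close> the error made inside the ball vanishes by dominated convergence,
  and the negative part converges monotonically. In particular the negative part has a finite integral, which is
  not clear beforehand: semiconcavity bounds the second differences only from above.
\<close>
lemma viscosity_imp_integral_inequality:
  fixes u :: "real ^ 'n \<Rightarrow> real" and A :: "real ^ 'n ^ 'n"
  assumes visc: "viscosity_nonlocal_MA_ge s \<Omega> u f"
    and \<Omega>: "open \<Omega>" "x \<in> \<Omega>" and f: "0 \<le> f x"
    and L: "0 < L" "L-lipschitz_on UNIV u" and C: "0 < C" "semiconcave C u"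
    and A: "positive_definite A" "det A = 1"
    and fin: "(\<integral>\<^sup>+y. ennreal (sd_bound L C (norm y) / norm (matrix_inv A *v y) powr (real CARD('n) + 2 * s)) \<partial>lborel) < \<infinity>"
  shows "(\<integral>\<^sup>+y. ennreal (- (second_difference u x y / norm (matrix_inv A *v y) powr (real CARD('n) + 2 * s))) \<partial>lborel)
      + ennreal (2 * f x)
    \<le> (\<integral>\<^sup>+y. ennreal (second_difference u x y / norm (matrix_inv A *v y) powr (real CARD('n) + 2 * s)) \<partial>lborel)"
proof -
  let ?w = "\<lambda>y. norm (matrix_inv A *v y) powr (real CARD('n) + 2 * s)"
  have u_cont: "continuous_on UNIV u" using C(2) by (simp add: semiconcave_def)
  then have u_meas [measurable]: "u \<in> borel_measurable borel"
    by (rule borel_measurable_continuous_onI)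
  have [measurable]: "(\<lambda>y. matrix_inv A *v y) \<in> borel_measurable borel"
    by (intro borel_measurable_continuous_onI matrix_vector_mult_linear_continuous_on)
  define D where "D y = second_difference u x y / ?w y" for y
  define E where "E y = 2 * sd_bound L C (norm y) / ?w y" for y
  have D_meas [measurable]: "D \<in> borel_measurable borel"
    unfolding D_def[abs_def] second_difference_def by measurable
  have E_meas [measurable]: "E \<in> borel_measurable borel"
    unfolding E_def[abs_def] by measurable
  have sd_nonneg: "0 \<le> sd_bound L C (norm y)" for y :: "real ^ 'n"
    using L C by (simp add: sd_bound_def)
  have E_nonneg: "0 \<le> E y" for y
    using sd_nonneg by (simp add: E_def)
  have E_fin: "(\<integral>\<^sup>+y. ennreal (E y) \<partial>lborel) < \<infinity>"
  proof -
    have "(\<integral>\<^sup>+y. ennreal (E y) \<partial>lborel) = (\<integral>\<^sup>+y. 2 * ennreal (sd_bound L C (norm y) / ?w y) \<partial>lborel)"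
    proof (rule nn_integral_cong)
      fix y :: "real ^ 'n"
      have "ennreal (E y) = ennreal (2 * (sd_bound L C (norm y) / ?w y))"
        by (simp add: E_def)
      also have "\<dots> = 2 * ennreal (sd_bound L C (norm y) / ?w y)"
        using sd_nonneg by (subst ennreal_mult) auto
      finally show "ennreal (E y) = 2 * ennreal (sd_bound L C (norm y) / ?w y)" .
    qed
    also have "\<dots> = 2 * (\<integral>\<^sup>+y. ennreal (sd_bound L C (norm y) / ?w y) \<partial>lborel)"
      by (rule nn_integral_cmult) measurable
    also have "\<dots> < \<infinity>" using fin by (simp add: ennreal_mult_less_top)
    finally show ?thesis .
  qed
  have D_le_E: "D y \<le> E y" for y
  proof -
    have "second_difference u x y \<le> 2 * sd_bound L C (norm y)"
      using second_difference_le_sd_bound[OF L(2) C(2), of x y] sd_nonneg[of y] by linarith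
    then show ?thesis by (simp add: D_def E_def divide_right_mono)
  qed
  obtain \<rho> where \<rho>: "0 < \<rho>" "ball x \<rho> \<subseteq> \<Omega>" using \<Omega> open_contains_ball by blast
  \<comment> \<open>Below \<open>2 * L / C\<close> the quadratic branch of \<^const>\<open>sd_bound\<close> is the smaller one.\<close>
  define R where "R = min \<rho> (2 * L / C)"
  have R: "0 < R" "R \<le> \<rho>" "R \<le> 2 * L / C" using \<rho> L C by (auto simp: R_def)
  obtain p where p: "\<And>y. u y \<le> u x + p \<bullet> (y - x) + C / 2 * (norm (y - x))\<^sup>2"
    using semiconcave_upper_paraboloid[OF C(2), of x] by blast
  \<comment> \<open>The coefficient \<open>C\<close> instead of \<open>C / 2\<close> makes the touching strict.\<close>
  define \<psi> where "\<psi> y = u x + p \<bullet> (y - x) + C * (norm (y - x))\<^sup>2" for y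
  have step: "(\<integral>\<^sup>+y. ennreal (- D y) * indicator {y. r \<le> norm y} y \<partial>lborel) + ennreal (2 * f x)
      \<le> (\<integral>\<^sup>+y. ennreal (D y) \<partial>lborel) + (\<integral>\<^sup>+y. ennreal (E y) * indicator {y. norm y < r} y \<partial>lborel)"
    if r: "0 < r" "r \<le> R" for r
  proof -
    define v where "v y = (if y \<in> ball x r then \<psi> y else u y)" for y
    have "ereal (f x) \<le> nonlocal_MA s v x"
    proof -
      have "\<psi> y > u y" if "y \<in> ball x r - {x}" for y
      proof -
        have "0 < C / 2 * (norm (y - x))\<^sup>2" using that C by auto
        then show ?thesis using p[of y] by (simp add: \<psi>_def)
      qed
      moreover have "C2_on_closure (ball x r) \<psi>"
        unfolding \<psi>_def[abs_def] by (rule C2_on_closure_paraboloid)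
      moreover have "ball x r \<subseteq> \<Omega>" using \<rho> R r by (meson order_trans subset_ball)
      moreover have "\<psi> x = u x" by (simp add: \<psi>_def)
      moreover have "open (ball x r)" "x \<in> ball x r" using r by auto
      ultimately show ?thesis
        using visc \<Omega>(2) unfolding viscosity_nonlocal_MA_ge_def v_def[abs_def] by blast
    qed
    also have "\<dots> \<le> ereal (1 / 2) * extended_integral lborel (\<lambda>y. second_difference v x y / ?w y)"
      unfolding nonlocal_MA_def using A by (intro INF_lower) auto
    also have "(\<lambda>y. second_difference v x y / ?w y) = (\<lambda>y. if norm y < r then E y else D y)"
    proof
      fix y :: "real ^ 'n"
      have "second_difference v x y = 2 * sd_bound L C (norm y)" if y: "norm y < r"
      proof -
        have "norm y \<le> 2 * L / C" using y r R(3) by linarith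
        then have "C * norm y \<le> 2 * L" using C(1) by (simp add: pos_le_divide_eq mult.commute)
        then have "C * norm y * norm y \<le> 2 * L * norm y" by (rule mult_right_mono) simp
        then have "sd_bound L C (norm y) = C * (norm y)\<^sup>2"
          by (simp add: sd_bound_def power2_eq_square)
        moreover have "x + y \<in> ball x r" "x - y \<in> ball x r" using y by (auto simp: dist_norm)
        moreover have "x \<in> ball x r" using r by simp
        ultimately show ?thesis
          by (simp add: second_difference_def v_def \<psi>_def)
      qed
      moreover have "second_difference v x y = second_difference u x y" if "\<not> norm y < r"
        using that r by (simp add: second_difference_def v_def dist_norm \<psi>_def)
      ultimately show "second_difference v x y / ?w y = (if norm y < r then E y else D y)"
        by (simp add: D_def E_def)
    qed
    finally have main: "ereal (f x) \<le> ereal (1 / 2) * extended_integral lborel (\<lambda>y. if norm y < r then E y else D y)" .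
    have "(\<integral>\<^sup>+y. ennreal (if norm y < r then E y else D y) \<partial>lborel) \<le> (\<integral>\<^sup>+y. ennreal (E y) \<partial>lborel)"
      using D_le_E by (intro nn_integral_mono) (simp add: ennreal_leI)
    also note E_fin
    finally have "(\<integral>\<^sup>+y. ennreal (- (if norm y < r then E y else D y)) \<partial>lborel) + ennreal (2 * f x)
       \<le> (\<integral>\<^sup>+y. ennreal (if norm y < r then E y else D y) \<partial>lborel)"
      by (rule le_half_extended_integralD[OF main _ f])
    also have "(\<integral>\<^sup>+y. ennreal (- (if norm y < r then E y else D y)) \<partial>lborel) =
      (\<integral>\<^sup>+y. ennreal (- D y) * indicator {y. r \<le> norm y} y \<partial>lborel)"
      using E_nonneg by (intro nn_integral_cong) (auto simp: indicator_def ennreal_neg)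
    also have "(\<integral>\<^sup>+y. ennreal (if norm y < r then E y else D y) \<partial>lborel)
      \<le> (\<integral>\<^sup>+y. ennreal (D y) + ennreal (E y) * indicator {y. norm y < r} y \<partial>lborel)"
      by (intro nn_integral_mono) (auto simp: indicator_def)
    also have "\<dots> = (\<integral>\<^sup>+y. ennreal (D y) \<partial>lborel) + (\<integral>\<^sup>+y. ennreal (E y) * indicator {y. norm y < r} y \<partial>lborel)"
      by (rule nn_integral_add) measurable
    finally show ?thesis by simp
  qed
  define r where "r j = R / real (Suc j)" for j
  have r: "0 < r j" "r j \<le> R" for j
    using R by (auto simp: r_def divide_le_eq mult_le_cancel_left1)
  have r_lim: "r \<longlonglongrightarrow> 0"
    unfolding r_def by (rule LIMSEQ_Suc[OF lim_const_over_n])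
  have r_eventually: "\<forall>\<^sub>F j in sequentially. r j < norm y" if "y \<noteq> 0" for y :: "real ^ 'n"
    using r_lim that by (intro order_tendstoD) auto
  have D0: "D 0 = 0" by (simp add: D_def second_difference_def)
  have "(\<lambda>j. \<integral>\<^sup>+y. ennreal (- D y) * indicator {y. r j \<le> norm y} y \<partial>lborel)
     \<longlonglongrightarrow> (\<integral>\<^sup>+y. ennreal (- D y) \<partial>lborel)"
  proof (rule nn_integral_LIMSEQ)
    show "incseq (\<lambda>j y. ennreal (- D y) * indicator {y. r j \<le> norm y} y)"
    proof (intro incseq_SucI le_funI mult_left_mono)
      fix j y
      have "r (Suc j) \<le> r j" using R by (simp add: r_def frac_le)
      then show "indicator {y. r j \<le> norm y} y \<le> (indicator {y. r (Suc j) \<le> norm y} y :: ennreal)"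
        by (auto simp: indicator_def)
    qed simp
    show "(\<lambda>j. ennreal (- D y) * indicator {y. r j \<le> norm y} y) \<longlonglongrightarrow> ennreal (- D y)" for y
    proof (cases "y = 0")
      case False
      then show ?thesis
        by (intro tendsto_eventually eventually_mono[OF r_eventually[OF False]]) auto
    qed (simp add: D0)
  qed measurable
  then have lim1: "(\<lambda>j. (\<integral>\<^sup>+y. ennreal (- D y) * indicator {y. r j \<le> norm y} y \<partial>lborel) + ennreal (2 * f x))
     \<longlonglongrightarrow> (\<integral>\<^sup>+y. ennreal (- D y) \<partial>lborel) + ennreal (2 * f x)"
    by (intro tendsto_add tendsto_const)
  have "(\<lambda>j. \<integral>\<^sup>+y. ennreal (E y) * indicator {y. norm y < r j} y \<partial>lborel) \<longlonglongrightarrow> (\<integral>\<^sup>+y. 0 \<partial>(lborel :: (real ^ 'n) measure))"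
  proof (rule nn_integral_dominated_convergence[where w="\<lambda>y. ennreal (E y)"])
    have "(\<lambda>j. ennreal (E y) * indicator {y. norm y < r j} y) \<longlonglongrightarrow> 0" for y
    proof (cases "y = 0")
      case False
      then show ?thesis
        by (intro tendsto_eventually eventually_mono[OF r_eventually[OF False]]) auto
    qed (simp add: E_def sd_bound_def)
    then show "AE y in lborel. (\<lambda>j. ennreal (E y) * indicator {y. norm y < r j} y) \<longlonglongrightarrow> 0" by simp
    show "AE y in lborel. ennreal (E y) * indicator {y. norm y < r j} y \<le> ennreal (E y)" for j
      by (auto simp: indicator_def)
  qed (use E_fin in auto)
  then have lim2: "(\<lambda>j. (\<integral>\<^sup>+y. ennreal (D y) \<partial>lborel) + (\<integral>\<^sup>+y. ennreal (E y) * indicator {y. norm y < r j} y \<partial>lborel))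
     \<longlonglongrightarrow> (\<integral>\<^sup>+y. ennreal (D y) \<partial>lborel) + 0"
    by (intro tendsto_add tendsto_const) simp
  have "(\<integral>\<^sup>+y. ennreal (- D y) \<partial>lborel) + ennreal (2 * f x) \<le> (\<integral>\<^sup>+y. ennreal (D y) \<partial>lborel) + 0"
    by (rule LIMSEQ_le[OF lim1 lim2]) (use step r in blast)
  then show ?thesis by (simp add: D_def)
qed

section \<open>Matrices stretched along one direction\<close>

text \<open>
  The inverse matrix acts as multiplication by \<open>a\<close> on the line spanned by \<open>e\<close> and by \<open>b\<close> on its orthogonal complement.
\<close>
lemma stretched_matrix_exists:
  fixes e :: "real ^ 'n"
  assumes e: "norm e = 1" and a: "0 < a" and b: "0 < b" and ab: "a * b ^ (CARD('n) - 1) = 1"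
  obtains A :: "real ^ 'n ^ 'n" where "positive_definite A" "det A = 1"
    "\<And>y. (norm (matrix_inv A *v y))\<^sup>2 = a\<^sup>2 * (e \<bullet> y)\<^sup>2 + b\<^sup>2 * (norm (y - (e \<bullet> y) *\<^sub>R e))\<^sup>2"
proof -
  obtain k :: 'n where True by simp
  obtain Q :: "real ^ 'n ^ 'n" where Q: "orthogonal_matrix Q" "Q *v axis k 1 = e"
    using orthogonal_matrix_exists_basis[OF e] by blast
  have QQ: "transpose Q ** Q = mat 1" "Q ** transpose Q = mat 1"
    using Q(1) by (auto simp: orthogonal_matrix_def)
  have QQv: "Q *v (transpose Q *v y) = y" for y
    unfolding matrix_vector_mul_assoc QQ by simp
  have ip: "x \<bullet> (Q *v w) = (transpose Q *v x) \<bullet> w" for x w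
    by (simp add: dot_lmul_matrix[symmetric])
  have nQ: "norm (Q *v w) = norm w" for w
    unfolding norm_eq ip matrix_vector_mul_assoc QQ by simp
  define D :: "real \<Rightarrow> real \<Rightarrow> real ^ 'n ^ 'n"
    where "D c d = (\<chi> i j. if i = j then if i = k then c else d else 0)" for c d
  have Dv: "(D c d *v z) $ i = (if i = k then c else d) * z $ i" for c d z i
  proof -
    have entry: "(if i = j then if i = k then c else d else 0) * z $ j =
        (if j = i then (if i = k then c else d) * z $ i else 0)" for j
      by auto
    show ?thesis unfolding matrix_vector_mult_def D_def vec_lambda_beta entry by simp
  qed
  have D_inv: "D c d ** D (1 / c) (1 / d) = mat 1" if "c \<noteq> 0" "d \<noteq> 0" for c d
    using that
    by (simp add: matrix_eq matrix_vector_mul_assoc[symmetric] vec_eq_iff Dv)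
  define M where "M c d = Q ** D c d ** transpose Q" for c d
  have Mv: "M c d *v y = Q *v (D c d *v (transpose Q *v y))" for c d y
    unfolding M_def matrix_vector_mul_assoc matrix_mul_assoc ..
  have M_inv: "M c d ** M (1 / c) (1 / d) = mat 1" if "c \<noteq> 0" "d \<noteq> 0" for c d
  proof -
    have "M c d ** M (1 / c) (1 / d) = Q ** D c d ** (transpose Q ** Q) ** D (1 / c) (1 / d) ** transpose Q"
      unfolding M_def by (simp add: matrix_mul_assoc)
    also have "\<dots> = Q ** (D c d ** D (1 / c) (1 / d)) ** transpose Q"
      by (simp add: QQ matrix_mul_assoc)
    finally show ?thesis by (simp add: D_inv[OF that] QQ)
  qed
  define A where "A = M (1 / a) (1 / b)"
  have inv: "matrix_inv A = M a b"
  proof -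
    have "A ** M a b = mat 1" "M a b ** A = mat 1"
      using M_inv[of "1 / a" "1 / b"] M_inv[of a b] a b by (auto simp: A_def)
    then have "\<exists>A'. A ** A' = mat 1 \<and> A' ** A = mat 1" by blast
    from someI_ex[OF this] have "matrix_inv A ** A = mat 1"
      by (simp add: matrix_inv_def)
    then show ?thesis
      by (metis \<open>A ** M a b = mat 1\<close> matrix_mul_assoc matrix_mul_lid matrix_mul_rid)
  qed
  show thesis
  proof
    show "positive_definite A"
      unfolding positive_definite_def
    proof (intro conjI allI impI)
      have "transpose (D c d) = D c d" for c d
        by (auto simp: D_def transpose_def vec_eq_iff)
      then show "transpose A = A"
        by (simp add: A_def M_def matrix_transpose_mul matrix_mul_assoc)
      fix x :: "real ^ 'n" assume x: "x \<noteq> 0"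
      define z where "z = transpose Q *v x"
      have "z \<noteq> 0" using x QQv[of x] by (auto simp: z_def)
      then obtain j where j: "z $ j \<noteq> 0" by (auto simp: vec_eq_iff)
      have "x \<bullet> (A *v x) = z \<bullet> (D (1 / a) (1 / b) *v z)"
        unfolding A_def Mv ip z_def ..
      also have "\<dots> = (\<Sum>i\<in>UNIV. (if i = k then 1 / a else 1 / b) * (z $ i)\<^sup>2)"
        unfolding inner_vec_def Dv
        by (intro sum.cong) (auto simp: power2_eq_square)
      also have "\<dots> > 0"
        using a b j by (intro sum_pos2[of _ j]) auto
      finally show "0 < x \<bullet> (A *v x)" .
    qed
    have "det (D c d) = c * d ^ (CARD('n) - 1)" for c d
    proof -
      have "det (D c d) = (\<Prod>i\<in>UNIV. if i = k then c else d)"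
        by (subst det_diagonal) (auto simp: D_def)
      also have "\<dots> = c * (\<Prod>i\<in>UNIV - {k}. d)"
        by (subst prod.remove[of _ k]) (auto intro!: prod.cong)
      finally show ?thesis by (simp add: card_Diff_singleton)
    qed
    moreover have "det Q * det (transpose Q) = 1"
      by (metis QQ(2) det_I det_mul)
    ultimately have "det A = 1 / a * (1 / b) ^ (CARD('n) - 1)"
      by (simp add: A_def M_def det_mul algebra_simps)
    also have "\<dots> = 1 / (a * b ^ (CARD('n) - 1))"
      by (simp add: power_divide)
    finally show "det A = 1" using ab by simp
    fix y :: "real ^ 'n"
    define z where "z = transpose Q *v y"
    have zk: "z $ k = e \<bullet> y"
      unfolding cart_eq_inner_axis z_def ip[symmetric] Q(2) by (rule inner_commute)
    have "z \<bullet> z = y \<bullet> y"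
      using ip[of y z] QQv[of y] by (simp add: z_def)
    moreover have "z \<bullet> z = (z $ k)\<^sup>2 + (\<Sum>i\<in>UNIV - {k}. (z $ i)\<^sup>2)"
      unfolding inner_vec_def by (subst sum.remove[of _ k]) (auto simp: power2_eq_square)
    moreover have "(norm (y - (e \<bullet> y) *\<^sub>R e))\<^sup>2 = y \<bullet> y - (e \<bullet> y)\<^sup>2"
      using e unfolding power2_norm_eq_inner
      by (simp add: inner_diff inner_commute power2_eq_square norm_eq_1)
    ultimately have rest: "(\<Sum>i\<in>UNIV - {k}. (z $ i)\<^sup>2) = (norm (y - (e \<bullet> y) *\<^sub>R e))\<^sup>2"
      by (simp add: zk)
    have "(norm (matrix_inv A *v y))\<^sup>2 = (D a b *v z) \<bullet> (D a b *v z)"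
      unfolding inv Mv nQ z_def by (simp add: power2_norm_eq_inner)
    also have "\<dots> = a\<^sup>2 * (z $ k)\<^sup>2 + (\<Sum>i\<in>UNIV - {k}. b\<^sup>2 * (z $ i)\<^sup>2)"
      unfolding inner_vec_def Dv
      by (subst sum.remove[of _ k]) (auto simp: power2_eq_square mult_ac intro!: sum.cong)
    finally show "(norm (matrix_inv A *v y))\<^sup>2 = a\<^sup>2 * (e \<bullet> y)\<^sup>2 + b\<^sup>2 * (norm (y - (e \<bullet> y) *\<^sub>R e))\<^sup>2"
      by (simp add: zk rest flip: sum_distrib_left)
  qed
qed

text \<open>
  Integrating the anisotropic kernel over the hyperplanes orthogonal to \<open>e\<close> leaves the kernel of the
  one-dimensional fractional Laplacian. The constant \<^const>\<open>C2_const\<close> is the area of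
  the unit sphere in such a hyperplane times the Beta integral that arises.
\<close>
lemma nn_integral_kernel_axial:
  fixes e :: "real ^ 'n" and G :: "real \<Rightarrow> ennreal"
  assumes dim: "2 \<le> CARD('n)" and e: "norm e = 1" and a: "0 < a" and b: "0 < b" and s: "0 < s"
    and G [measurable]: "G \<in> borel_measurable borel"
  shows "(\<integral>\<^sup>+y. G (e \<bullet> y) * ennreal (1 / (a\<^sup>2 * (e \<bullet> y)\<^sup>2 + b\<^sup>2 * (norm (y - (e \<bullet> y) *\<^sub>R e))\<^sup>2)
        powr (real CARD('n) / 2 + s)) \<partial>lborel) =
    ennreal (C2_const CARD('n) s * (a powr (- 1 - 2 * s) * b powr (1 - real CARD('n)))) *
      (\<integral>\<^sup>+t. G t * ennreal (1 / \<bar>t\<bar> powr (1 + 2 * s)) \<partial>lborel)"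
proof -
  define n where "n = real CARD('n)"
  define \<omega> where "\<omega> = sphere_area (CARD('n) - 1)"
  have n: "2 \<le> n" using dim by (simp add: n_def)
  have \<omega>: "0 \<le> \<omega>" using dim by (simp add: \<omega>_def sphere_area_def Gamma_real_pos less_imp_le)
  define c where "c = C2_const CARD('n) s * (a powr (- 1 - 2 * s) * b powr (1 - n))"
  have inner: "(\<integral>\<^sup>+r\<in>{0<..}. G t * ennreal (1 / (a\<^sup>2 * t\<^sup>2 + b\<^sup>2 * r\<^sup>2) powr (n / 2 + s)) * ennreal (\<omega> * r powr (n - 2)) \<partial>lborel)
     = ennreal c * (G t * ennreal (1 / \<bar>t\<bar> powr (1 + 2 * s)))" if t: "t \<noteq> 0" for t
  proof -
    define T where "T = a * \<bar>t\<bar>"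
    have T: "0 < T" "a\<^sup>2 * t\<^sup>2 = T\<^sup>2" using a t by (auto simp: T_def power_mult_distrib)
    have "(\<integral>\<^sup>+r\<in>{0<..}. G t * ennreal (1 / (a\<^sup>2 * t\<^sup>2 + b\<^sup>2 * r\<^sup>2) powr (n / 2 + s)) * ennreal (\<omega> * r powr (n - 2)) \<partial>lborel)
      = (\<integral>\<^sup>+r. G t * ennreal \<omega> * (ennreal (r powr ((n - 1) - 1) / (T\<^sup>2 + b\<^sup>2 * r\<^sup>2) powr (n / 2 + s)) * indicator {0<..} r) \<partial>lborel)"
    proof (rule nn_integral_cong)
      fix r :: real
      define S where "S = (T\<^sup>2 + b\<^sup>2 * r\<^sup>2) powr (n / 2 + s)"
      have "ennreal (1 / S) * ennreal (\<omega> * r powr (n - 2)) = ennreal \<omega> * ennreal (r powr ((n - 1) - 1) / S)"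
        using \<omega> by (simp add: S_def ennreal_mult[symmetric])
      then show "G t * ennreal (1 / (a\<^sup>2 * t\<^sup>2 + b\<^sup>2 * r\<^sup>2) powr (n / 2 + s)) * ennreal (\<omega> * r powr (n - 2)) * indicator {0<..} r
         = G t * ennreal \<omega> * (ennreal (r powr ((n - 1) - 1) / (T\<^sup>2 + b\<^sup>2 * r\<^sup>2) powr (n / 2 + s)) * indicator {0<..} r)"
        unfolding T(2) S_def[symmetric] by (metis mult.assoc)
    qed
    also have "\<dots> = G t * ennreal \<omega> * (\<integral>\<^sup>+r\<in>{0<..}. ennreal (r powr ((n - 1) - 1) / (T\<^sup>2 + b\<^sup>2 * r\<^sup>2) powr (n / 2 + s)) \<partial>lborel)"
      by (rule nn_integral_cmult) measurable
    also have "(\<integral>\<^sup>+r\<in>{0<..}. ennreal (r powr ((n - 1) - 1) / (T\<^sup>2 + b\<^sup>2 * r\<^sup>2) powr (n / 2 + s)) \<partial>lborel)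
       = ennreal (Gamma ((n - 1) / 2) * Gamma (n / 2 + s - (n - 1) / 2) / (2 * Gamma (n / 2 + s)) * (T powr ((n - 1) - 2 * (n / 2 + s)) / b powr (n - 1)))"
      using T(1) b n s by (intro nn_integral_Beta_quadratic) auto
    also have "G t * ennreal \<omega> * ennreal (Gamma ((n - 1) / 2) * Gamma (n / 2 + s - (n - 1) / 2) / (2 * Gamma (n / 2 + s)) * (T powr ((n - 1) - 2 * (n / 2 + s)) / b powr (n - 1)))
       = G t * ennreal (\<omega> * (Gamma ((n - 1) / 2) * Gamma (n / 2 + s - (n - 1) / 2) / (2 * Gamma (n / 2 + s)) * (T powr ((n - 1) - 2 * (n / 2 + s)) / b powr (n - 1))))"
      using \<omega> by (subst mult.assoc, subst ennreal_mult'[symmetric]) simp_all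
    also have "\<omega> * (Gamma ((n - 1) / 2) * Gamma (n / 2 + s - (n - 1) / 2) / (2 * Gamma (n / 2 + s)) * (T powr ((n - 1) - 2 * (n / 2 + s)) / b powr (n - 1)))
       = c * (1 / \<bar>t\<bar> powr (1 + 2 * s))"
    proof -
      have k: "n / 2 + s - (n - 1) / 2 = s + 1 / 2" "(n - 1) - 2 * (n / 2 + s) = - (1 + 2 * s)"
        by (simp_all add: field_simps)
      have kT: "T powr (- (1 + 2 * s)) = a powr (- 1 - 2 * s) * (1 / \<bar>t\<bar> powr (1 + 2 * s))"
      proof -
        have "- 1 - 2 * s = - (1 + 2 * s)" by simp
        then show ?thesis
          unfolding T_def using a by (simp only: powr_minus_divide powr_mult) simp
      qed
      have kb: "b powr (1 - n) = 1 / b powr (n - 1)"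
        by (metis minus_diff_eq powr_minus_divide)
      show ?thesis
        unfolding c_def C2_const_def n_def[symmetric] \<omega>_def[symmetric] k kT kb by (simp add: mult_ac)
    qed
    also have "G t * ennreal (c * (1 / \<bar>t\<bar> powr (1 + 2 * s))) = ennreal c * (G t * ennreal (1 / \<bar>t\<bar> powr (1 + 2 * s)))"
      by (subst ennreal_mult'') (simp_all add: mult_ac)
    finally show ?thesis .
  qed
  have "(\<integral>\<^sup>+y. G (e \<bullet> y) * ennreal (1 / (a\<^sup>2 * (e \<bullet> y)\<^sup>2 + b\<^sup>2 * (norm (y - (e \<bullet> y) *\<^sub>R e))\<^sup>2)
        powr (n / 2 + s)) \<partial>lborel) =
     (\<integral>\<^sup>+t. (\<integral>\<^sup>+r\<in>{0<..}. G t * ennreal (1 / (a\<^sup>2 * t\<^sup>2 + b\<^sup>2 * r\<^sup>2) powr (n / 2 + s)) * ennreal (\<omega> * r powr (n - 2)) \<partial>lborel) \<partial>lborel)"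
    unfolding n_def \<omega>_def
    by (rule nn_integral_cylindrical[OF dim e, where F="\<lambda>t r. G t * ennreal (1 / (a\<^sup>2 * t\<^sup>2 + b\<^sup>2 * r\<^sup>2) powr (real CARD('n) / 2 + s))"]) measurable
  also have "\<dots> = (\<integral>\<^sup>+t. ennreal c * (G t * ennreal (1 / \<bar>t\<bar> powr (1 + 2 * s))) \<partial>lborel)"
    using AE_lborel_singleton[of "0::real"] by (intro nn_integral_cong_AE) (auto simp: inner)
  also have "\<dots> = ennreal c * (\<integral>\<^sup>+t. G t * ennreal (1 / \<bar>t\<bar> powr (1 + 2 * s)) \<partial>lborel)"
    by (rule nn_integral_cmult) measurable
  finally show ?thesis by (simp add: n_def c_def)
qed

text \<open>
  The counterpart of the previous lemma for a function of the distance to the line spanned by \<open>e\<close>: now the kernel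
  is integrated along the line first, and the power of the distance coming from polar coordinates in the orthogonal
  complement reduces the exponent to the one-dimensional one.
\<close>
lemma nn_integral_kernel_transversal:
  fixes e :: "real ^ 'n" and H :: "real \<Rightarrow> ennreal"
  assumes dim: "2 \<le> CARD('n)" and e: "norm e = 1" and a: "0 < a" and b: "0 < b" and s: "0 < s"
    and H [measurable]: "H \<in> borel_measurable borel"
  shows "(\<integral>\<^sup>+y. H (norm (y - (e \<bullet> y) *\<^sub>R e)) * ennreal (1 / (a\<^sup>2 * (e \<bullet> y)\<^sup>2 + b\<^sup>2 * (norm (y - (e \<bullet> y) *\<^sub>R e))\<^sup>2)
        powr (real CARD('n) / 2 + s)) \<partial>lborel) =
    ennreal (sphere_area (CARD('n) - 1) * (sqrt pi * Gamma ((real CARD('n) - 1) / 2 + s) / Gamma (real CARD('n) / 2 + s))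
        * (b powr (1 - real CARD('n) - 2 * s) / a)) *
      (\<integral>\<^sup>+r\<in>{0<..}. H r * ennreal (1 / r powr (1 + 2 * s)) \<partial>lborel)"
proof -
  define n where "n = real CARD('n)"
  define \<omega> where "\<omega> = sphere_area (CARD('n) - 1)"
  have n: "2 \<le> n" using dim by (simp add: n_def)
  have \<omega>: "0 \<le> \<omega>" using dim by (simp add: \<omega>_def sphere_area_def Gamma_real_pos less_imp_le)
  define c where "c = \<omega> * (sqrt pi * Gamma ((n - 1) / 2 + s) / Gamma (n / 2 + s)) * (b powr (1 - n - 2 * s) / a)"
  have inner: "(\<integral>\<^sup>+t. ennreal (1 / (a\<^sup>2 * t\<^sup>2 + b\<^sup>2 * r\<^sup>2) powr (n / 2 + s)) \<partial>lborel) =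
      ennreal (sqrt pi * Gamma ((n - 1) / 2 + s) / Gamma (n / 2 + s) * ((b * r) powr (1 - n - 2 * s) / a))"
    if r: "0 < r" for r
  proof -
    have "(\<integral>\<^sup>+t. ennreal (1 / (a\<^sup>2 * t\<^sup>2 + b\<^sup>2 * r\<^sup>2) powr (n / 2 + s)) \<partial>lborel) =
       (\<integral>\<^sup>+t. ennreal (1 / (a\<^sup>2 * \<bar>t\<bar>\<^sup>2 + b\<^sup>2 * r\<^sup>2) powr (n / 2 + s)) \<partial>lborel)"
      by simp
    also have "\<dots> = 2 * (\<integral>\<^sup>+t\<in>{0<..}. ennreal (1 / (a\<^sup>2 * t\<^sup>2 + b\<^sup>2 * r\<^sup>2) powr (n / 2 + s)) \<partial>lborel)"
      by (rule nn_integral_even) measurable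
    also have "(\<integral>\<^sup>+t\<in>{0<..}. ennreal (1 / (a\<^sup>2 * t\<^sup>2 + b\<^sup>2 * r\<^sup>2) powr (n / 2 + s)) \<partial>lborel)
       = (\<integral>\<^sup>+t\<in>{0<..}. ennreal (t powr (1 - 1) / ((b * r)\<^sup>2 + a\<^sup>2 * t\<^sup>2) powr (n / 2 + s)) \<partial>lborel)"
      by (intro nn_integral_cong) (auto simp: indicator_def power_mult_distrib add.commute)
    also have "\<dots> = ennreal (Gamma (1 / 2) * Gamma (n / 2 + s - 1 / 2) / (2 * Gamma (n / 2 + s)) * ((b * r) powr (1 - 2 * (n / 2 + s)) / a powr 1))"
      using a b r n s by (intro nn_integral_Beta_quadratic) auto
    also have "2 * \<dots> = ennreal (2 * (Gamma (1 / 2) * Gamma (n / 2 + s - 1 / 2) / (2 * Gamma (n / 2 + s)) * ((b * r) powr (1 - 2 * (n / 2 + s)) / a powr 1)))"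
      by (subst ennreal_mult') auto
    also have "2 * (Gamma (1 / 2) * Gamma (n / 2 + s - 1 / 2) / (2 * Gamma (n / 2 + s)) * ((b * r) powr (1 - 2 * (n / 2 + s)) / a powr 1))
       = sqrt pi * Gamma ((n - 1) / 2 + s) / Gamma (n / 2 + s) * ((b * r) powr (1 - n - 2 * s) / a)"
    proof -
      have k: "n / 2 + s - 1 / 2 = (n - 1) / 2 + s" "1 - 2 * (n / 2 + s) = 1 - n - 2 * s"
        by (simp_all add: field_simps)
      show ?thesis unfolding k using a by (simp add: Gamma_one_half_real)
    qed
    finally show ?thesis .
  qed
  have "(\<integral>\<^sup>+y. H (norm (y - (e \<bullet> y) *\<^sub>R e)) * ennreal (1 / (a\<^sup>2 * (e \<bullet> y)\<^sup>2 + b\<^sup>2 * (norm (y - (e \<bullet> y) *\<^sub>R e))\<^sup>2)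
        powr (n / 2 + s)) \<partial>lborel) =
     (\<integral>\<^sup>+t. (\<integral>\<^sup>+r\<in>{0<..}. H r * ennreal (1 / (a\<^sup>2 * t\<^sup>2 + b\<^sup>2 * r\<^sup>2) powr (n / 2 + s)) * ennreal (\<omega> * r powr (n - 2)) \<partial>lborel) \<partial>lborel)"
    unfolding n_def \<omega>_def
    by (rule nn_integral_cylindrical[OF dim e, where F="\<lambda>t r. H r * ennreal (1 / (a\<^sup>2 * t\<^sup>2 + b\<^sup>2 * r\<^sup>2) powr (real CARD('n) / 2 + s))"]) measurable
  also have "\<dots> = (\<integral>\<^sup>+r. (\<integral>\<^sup>+t. H r * ennreal (1 / (a\<^sup>2 * t\<^sup>2 + b\<^sup>2 * r\<^sup>2) powr (n / 2 + s)) * ennreal (\<omega> * r powr (n - 2)) * indicator {0<..} r \<partial>lborel) \<partial>lborel)"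
    by (rule lborel_pair.Fubini') measurable
  also have "\<dots> = (\<integral>\<^sup>+r. ennreal c * (H r * ennreal (1 / r powr (1 + 2 * s)) * indicator {0<..} r) \<partial>lborel)"
  proof (rule nn_integral_cong)
    fix r :: real
    show "(\<integral>\<^sup>+t. H r * ennreal (1 / (a\<^sup>2 * t\<^sup>2 + b\<^sup>2 * r\<^sup>2) powr (n / 2 + s)) * ennreal (\<omega> * r powr (n - 2)) * indicator {0<..} r \<partial>lborel) =
       ennreal c * (H r * ennreal (1 / r powr (1 + 2 * s)) * indicator {0<..} r)"
    proof (cases "0 < r")
      case True
      have "(\<integral>\<^sup>+t. H r * ennreal (1 / (a\<^sup>2 * t\<^sup>2 + b\<^sup>2 * r\<^sup>2) powr (n / 2 + s)) * ennreal (\<omega> * r powr (n - 2)) * indicator {0<..} r \<partial>lborel)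
        = (\<integral>\<^sup>+t. (H r * ennreal (\<omega> * r powr (n - 2))) * ennreal (1 / (a\<^sup>2 * t\<^sup>2 + b\<^sup>2 * r\<^sup>2) powr (n / 2 + s)) \<partial>lborel)"
        using True by (intro nn_integral_cong) (simp add: mult_ac)
      also have "\<dots> = (H r * ennreal (\<omega> * r powr (n - 2))) * ennreal (sqrt pi * Gamma ((n - 1) / 2 + s) / Gamma (n / 2 + s) * ((b * r) powr (1 - n - 2 * s) / a))"
        by (subst nn_integral_cmult) (simp_all add: inner[OF True])
      also have "\<dots> = H r * ennreal (\<omega> * r powr (n - 2) * (sqrt pi * Gamma ((n - 1) / 2 + s) / Gamma (n / 2 + s) * ((b * r) powr (1 - n - 2 * s) / a)))"
        using \<omega> by (subst mult.assoc, subst ennreal_mult'[symmetric]) simp_all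
      also have "\<omega> * r powr (n - 2) * (sqrt pi * Gamma ((n - 1) / 2 + s) / Gamma (n / 2 + s) * ((b * r) powr (1 - n - 2 * s) / a))
         = c * (1 / r powr (1 + 2 * s))"
      proof -
        have kb: "(b * r) powr (1 - n - 2 * s) = b powr (1 - n - 2 * s) * r powr (1 - n - 2 * s)"
          using b True by (simp add: powr_mult)
        have kr: "r powr (n - 2) * r powr (1 - n - 2 * s) = 1 / r powr (1 + 2 * s)"
          by (simp add: powr_add[symmetric] powr_minus_divide[symmetric])
        have "\<omega> * r powr (n - 2) * (g * (b powr (1 - n - 2 * s) * r powr (1 - n - 2 * s) / a))
            = \<omega> * g * (b powr (1 - n - 2 * s) / a) * (r powr (n - 2) * r powr (1 - n - 2 * s))" for g
          by simp
        then show ?thesis unfolding c_def kb kr .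
      qed
      also have "H r * ennreal (c * (1 / r powr (1 + 2 * s))) = ennreal c * (H r * ennreal (1 / r powr (1 + 2 * s)))"
        by (subst ennreal_mult'') (simp_all add: mult_ac)
      finally show ?thesis using True by simp
    qed simp
  qed
  also have "\<dots> = ennreal c * (\<integral>\<^sup>+r\<in>{0<..}. H r * ennreal (1 / r powr (1 + 2 * s)) \<partial>lborel)"
    by (rule nn_integral_cmult) measurable
  finally show ?thesis by (simp add: n_def c_def \<omega>_def)
qed

section \<open>The majorant and its integral\<close>

text \<open>
  The quadratic bound makes the integral converge at \<open>0\<close> since \<open>s < 1\<close>, and the linear one at infinity
  since \<open>2 * s > 1\<close>.
\<close>
lemma nn_integral_sd_bound_finite:
  assumes s: "1 / 2 < s" "s < 1" and L: "0 < L" and C: "0 < C"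
  shows "(\<integral>\<^sup>+r\<in>{0<..}. ennreal (sd_bound L C r / r powr (1 + 2 * s)) \<partial>lborel) < \<infinity>"
proof -
  have near: "(\<integral>\<^sup>+r. ennreal (C * r powr (1 - 2 * s)) * indicator {0..1} r \<partial>lborel)
      = ennreal (C * (1 powr (1 - 2 * s + 1) / (1 - 2 * s + 1)))"
    using s C has_integral_mult_right[OF has_integral_powr_from_0[of "1 - 2 * s" 1], of C]
    by (intro nn_integral_has_integral_lebesgue') auto
  have far: "(\<integral>\<^sup>+r. ennreal (2 * L * r powr (- 2 * s)) * indicator {1..} r \<partial>lborel)
      = ennreal (2 * L * (- (1 powr (- 2 * s + 1)) / (- 2 * s + 1)))"
    using s L has_integral_mult_right[OF has_integral_powr_to_inf[of "- 2 * s" 1], of "2 * L"]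
    by (intro nn_integral_has_integral_lebesgue') auto
  have "(\<integral>\<^sup>+r\<in>{0<..}. ennreal (sd_bound L C r / r powr (1 + 2 * s)) \<partial>lborel)
     \<le> (\<integral>\<^sup>+r. ennreal (C * r powr (1 - 2 * s)) * indicator {0..1} r + ennreal (2 * L * r powr (- 2 * s)) * indicator {1..} r \<partial>lborel)"
  proof (rule nn_integral_mono)
    fix r :: real
    consider "r \<le> 0" | "0 < r" "r < 1" | "1 \<le> r" by linarith
    then show "ennreal (sd_bound L C r / r powr (1 + 2 * s)) * indicator {0<..} r
        \<le> ennreal (C * r powr (1 - 2 * s)) * indicator {0..1} r + ennreal (2 * L * r powr (- 2 * s)) * indicator {1..} r"
    proof cases
      case 2
      have "r powr (1 - 2 * s) = r\<^sup>2 / r powr (1 + 2 * s)"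
        using 2 by (simp flip: powr_numeral powr_diff)
      moreover have "sd_bound L C r / r powr (1 + 2 * s) \<le> C * r\<^sup>2 / r powr (1 + 2 * s)"
        by (intro divide_right_mono) (auto simp: sd_bound_def)
      ultimately show ?thesis using 2 by (simp add: ennreal_leI)
    next
      case 3
      have "r powr (- 2 * s) = r powr 1 / r powr (1 + 2 * s)"
      proof -
        have "- 2 * s = 1 - (1 + 2 * s)" by simp
        then show ?thesis by (simp only: powr_diff)
      qed
      moreover have "sd_bound L C r / r powr (1 + 2 * s) \<le> 2 * L * r / r powr (1 + 2 * s)"
        by (intro divide_right_mono) (auto simp: sd_bound_def)
      ultimately have "ennreal (sd_bound L C r / r powr (1 + 2 * s)) \<le> ennreal (2 * L * r powr (- 2 * s))"
        using 3 by (intro ennreal_leI) simp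
      then show ?thesis using 3 by (simp add: add_increasing)
    qed simp
  qed
  also have "\<dots> = (\<integral>\<^sup>+r. ennreal (C * r powr (1 - 2 * s)) * indicator {0..1} r \<partial>lborel)
     + (\<integral>\<^sup>+r. ennreal (2 * L * r powr (- 2 * s)) * indicator {1..} r \<partial>lborel)"
    by (rule nn_integral_add) measurable
  also have "\<dots> < \<infinity>" unfolding near far by simp
  finally show ?thesis .
qed

text \<open>
  The integral defining \<^const>\<open>mu1\<close> runs over both half-lines, which cancels the factor \<open>1 / 2\<close> there.
\<close>
lemma nn_integral_sd_bound_mu1:
  assumes s: "1 / 2 < s" "s < 1" and L: "0 < L" and C: "0 < C"
  shows "(\<integral>\<^sup>+r\<in>{0<..}. ennreal (sd_bound L C r / r powr (1 + 2 * s)) \<partial>lborel) = ennreal (mu1 s L C / (1 - s))"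
    and "0 < mu1 s L C"
    and "integrable lborel (\<lambda>t. sd_bound L C \<bar>t\<bar> / \<bar>t\<bar> powr (1 + 2 * s))"
proof -
  let ?f = "\<lambda>r. sd_bound L C r / r powr (1 + 2 * s)"
  define J where "J = (\<integral>\<^sup>+r\<in>{0<..}. ennreal (?f r) \<partial>lborel)"
  have J_fin: "J < \<infinity>" using nn_integral_sd_bound_finite[OF assms] by (simp add: J_def)
  have nonneg: "0 \<le> ?f \<bar>t\<bar>" for t
    using L C by (simp add: sd_bound_def)
  have even: "(\<integral>\<^sup>+t. ennreal (?f \<bar>t\<bar>) \<partial>lborel) = 2 * J"
    unfolding J_def by (rule nn_integral_even[of "\<lambda>r. ennreal (?f r)"]) measurable
  show "integrable lborel (\<lambda>t. ?f \<bar>t\<bar>)"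
    using nonneg J_fin by (intro integrableI_nonneg) (auto simp: even ennreal_mult_less_top)
  have "J \<noteq> 0"
  proof
    assume "J = 0"
    then have "AE r in lborel. ennreal (?f r) * indicator {0<..} r = 0"
      unfolding J_def by (subst (asm) nn_integral_0_iff_AE) auto
    moreover have "ennreal (?f r) \<noteq> 0" if "0 < r" for r
      using that L C by (simp add: sd_bound_def ennreal_eq_0_iff not_le)
    ultimately have ae: "AE r in lborel. r \<notin> {0<..(1::real)}"
      by (auto simp: indicator_def elim!: eventually_mono split: if_splits)
    have "{r \<in> space lborel. \<not> r \<notin> {0<..(1::real)}} = {0<..1}" by auto
    from iffD1[OF AE_iff_measurable[OF _ this] ae] show False by simp
  qed
  then obtain j where j: "J = ennreal j" "0 < j"
    using J_fin by (cases J) (auto simp: ennreal_eq_0_iff not_le)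
  have "(LINT t|lborel. ?f \<bar>t\<bar>) = enn2real (2 * J)"
    using nonneg by (subst integral_eq_nn_integral) (auto simp: even)
  also have "2 * J = ennreal (2 * j)"
    using j by (subst ennreal_mult) auto
  finally have "mu1 s L C = (1 - s) * j"
    using j by (simp add: mu1_def sd_bound_def)
  then show "0 < mu1 s L C" "(\<integral>\<^sup>+r\<in>{0<..}. ennreal (?f r) \<partial>lborel) = ennreal (mu1 s L C / (1 - s))"
    using j s unfolding J_def by auto
qed

section \<open>Reduction to one direction\<close>

text \<open>
  The difference of the two sides without the majorant consists of the second differences centred at \<open>p\<close> and \<open>- p\<close>
  with increment \<open>q\<close>, and these are controlled from above. For a single sign of \<open>q\<close> the error would
  contain first differences, which are only linear in \<open>q\<close>.
\<close>
lemma second_difference_add_reflection_le: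
  fixes u :: "'a::euclidean_space \<Rightarrow> real"
  assumes "L-lipschitz_on UNIV u" "semiconcave C u"
  shows "second_difference u 0 (p + q) + second_difference u 0 (p - q)
    \<le> 2 * second_difference u 0 p + 2 * sd_bound L C (norm q)"
proof -
  have "second_difference u 0 (p + q) + second_difference u 0 (p - q)
    = 2 * second_difference u 0 p + second_difference u p q + second_difference u (- p) q"
    by (simp add: second_difference_def algebra_simps)
  then show ?thesis
    using second_difference_le_sd_bound[OF assms, of p q] second_difference_le_sd_bound[OF assms, of "- p" q]
    by linarith
qed

text \<open>
  This reduces the integrability of the majorant against an anisotropic kernel to its integrability in
  the two cylindrical coordinates. Doubling the argument multiplies the majorant by at most \<open>4\<close>, and the hypotenuse of a right-angled triangle is at most
  twice the longer leg.
\<close>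
lemma sd_bound_le_components:
  assumes "0 \<le> L" "0 \<le> C" "0 \<le> x" "0 \<le> y" "0 \<le> r" and r: "r\<^sup>2 = x\<^sup>2 + y\<^sup>2"
  shows "sd_bound L C r \<le> 4 * sd_bound L C x + 4 * sd_bound L C y"
proof -
  have double: "sd_bound L C r \<le> 4 * sd_bound L C z" if "0 \<le> z" "r\<^sup>2 \<le> 4 * z\<^sup>2" for z
  proof -
    have "r \<le> 2 * z" using power2_le_imp_le[of r "2 * z"] that by (simp add: power_mult_distrib)
    then have "L * r \<le> L * (2 * z)" using \<open>0 \<le> L\<close> by (rule mult_left_mono)
    moreover have "C * r\<^sup>2 \<le> C * (4 * z\<^sup>2)" using that(2) \<open>0 \<le> C\<close> by (rule mult_left_mono)
    moreover have "0 \<le> L * z" using that(1) \<open>0 \<le> L\<close> by simp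
    ultimately show ?thesis by (auto simp: sd_bound_def min_def)
  qed
  have nonneg: "0 \<le> sd_bound L C x" "0 \<le> sd_bound L C y"
    using assms by (auto simp: sd_bound_def)
  show ?thesis
  proof (cases "x \<le> y")
    case True
    then have "x\<^sup>2 \<le> y\<^sup>2" using assms by (intro power_mono) auto
    then have "r\<^sup>2 \<le> 4 * y\<^sup>2" unfolding r using zero_le_power2[of y] by linarith
    then show ?thesis using double[of y] \<open>0 \<le> y\<close> nonneg by linarith
  next
    case False
    then have "y\<^sup>2 \<le> x\<^sup>2" using assms by (intro power_mono) auto
    then have "r\<^sup>2 \<le> 4 * x\<^sup>2" unfolding r using zero_le_power2[of x] by linarith
    then show ?thesis using double[of x] \<open>0 \<le> x\<close> nonneg by linarith
  qed
qed

lemma orthogonal_transformation_axis_reflection: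
  fixes e :: "'a::euclidean_space"
  assumes "norm e = 1"
  shows "orthogonal_transformation (\<lambda>y. (e \<bullet> y) *\<^sub>R e - (y - (e \<bullet> y) *\<^sub>R e))"
  using assms unfolding orthogonal_transformation_def norm_eq_1
  by (auto intro!: linearI simp: inner_simps inner_commute algebra_simps)

text \<open>
  The cancellation at the end of the reflection argument. Only the finiteness of \<open>p\<close>, hence of \<open>q\<close>, is available:
  \<open>d\<close> will be the integral of the negative part of the one-dimensional second difference, whose
  finiteness is a consequence.
\<close>
lemma ennreal_cancel_doubled:
  fixes c d d' m p q :: ennreal
  assumes le: "q + c \<le> p" and fin: "p < \<infinity>" and doubled: "2 * d + (p + p) \<le> 2 * d' + 2 * m + (q + q)"
  shows "d + c \<le> d' + m"
proof -
  have "q \<noteq> \<infinity>" using le fin by (auto simp: top_unique)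
  have "(q + q) + 2 * (d + c) = 2 * d + ((q + c) + (q + c))"
    by (simp only: mult_2 add_ac)
  also have "\<dots> \<le> 2 * d + (p + p)"
    by (intro add_left_mono add_mono le)
  also note doubled
  also have "2 * d' + 2 * m + (q + q) = (q + q) + 2 * (d' + m)"
    by (simp add: distrib_left ac_simps)
  finally have "2 * (d + c) \<le> 2 * (d' + m)"
    using \<open>q \<noteq> \<infinity>\<close> by (simp add: ennreal_add_left_cancel_le)
  then show ?thesis by (subst (asm) ennreal_mult_le_mult_iff) auto
qed

text \<open>
  Insert into the classical inequality a matrix that is stretched along \<open>e\<close>, and average over the reflection that
  fixes \<open>e\<close> and is \<open>- 1\<close> on its orthogonal complement. The kernel is invariant under the reflection, and the mean of the second differences over it
  is at most the one along \<open>e\<close> plus the majorant of the orthogonal component. Both terms integrate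
  explicitly in cylindrical coordinates. Positive and negative parts are kept on different sides, so that
  the inequality makes sense before integrability is known.
\<close>
lemma viscosity_imp_axial_inequality:
  fixes u :: "real ^ 'n \<Rightarrow> real" and e :: "real ^ 'n"
  assumes dim: "2 \<le> CARD('n)" and s: "1 / 2 < s" "s < 1"
    and visc: "viscosity_nonlocal_MA_ge s \<Omega> u f"
    and \<Omega>: "open \<Omega>" "0 \<in> \<Omega>" and f: "0 \<le> f 0"
    and L: "0 < L" "L-lipschitz_on UNIV u" and C: "0 < C" "semiconcave C u"
    and e: "norm e = 1" and a: "0 < a" and b: "0 < b" and ab: "a * b ^ (CARD('n) - 1) = 1"
  defines "g \<equiv> \<lambda>t. second_difference u 0 (t *\<^sub>R e) / \<bar>t\<bar> powr (1 + 2 * s)"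
    and "c2 \<equiv> C2_const CARD('n) s * a powr (- 2 * s)"
  shows "ennreal c2 * (\<integral>\<^sup>+t. ennreal (- g t) \<partial>lborel) + ennreal (2 * f 0)
    \<le> ennreal c2 * (\<integral>\<^sup>+t. ennreal (g t) \<partial>lborel) + ennreal (2 * C1_const CARD('n) s L C * b powr (- 2 * s) / (1 - s))"
proof -
  obtain A :: "real ^ 'n ^ 'n" where A: "positive_definite A" "det A = 1"
    and A_norm: "\<And>y. (norm (matrix_inv A *v y))\<^sup>2 = a\<^sup>2 * (e \<bullet> y)\<^sup>2 + b\<^sup>2 * (norm (y - (e \<bullet> y) *\<^sub>R e))\<^sup>2"
    using stretched_matrix_exists[OF e a b ab] by blast
  define \<delta> where "\<delta> y = second_difference u 0 y" for y
  define d where "d t = second_difference u 0 (t *\<^sub>R e)" for t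
  define m where "m = sd_bound L C"
  define q where "q y = y - (e \<bullet> y) *\<^sub>R e" for y
  \<comment> \<open>The reflection: \<open>q y\<close> is the component of \<open>y\<close> orthogonal to \<open>e\<close>.\<close>
  define S where "S y = (e \<bullet> y) *\<^sub>R e - q y" for y
  define \<kappa> where "\<kappa> y = 1 / (a\<^sup>2 * (e \<bullet> y)\<^sup>2 + b\<^sup>2 * (norm (q y))\<^sup>2) powr (real CARD('n) / 2 + s)" for y
  have "continuous_on UNIV u" using C(2) by (simp add: semiconcave_def)
  then have [measurable]: "u \<in> borel_measurable borel"
    by (rule borel_measurable_continuous_onI)
  have [measurable]: "\<delta> \<in> borel_measurable borel" "d \<in> borel_measurable borel"
    unfolding \<delta>_def[abs_def] d_def[abs_def] second_difference_def by measurable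
  have [measurable]: "m \<in> borel_measurable borel" by (simp add: m_def)
  have [measurable]: "q \<in> borel_measurable borel" "S \<in> borel_measurable borel"
    unfolding q_def[abs_def] S_def[abs_def] by measurable
  have [measurable]: "\<kappa> \<in> borel_measurable borel"
    unfolding \<kappa>_def[abs_def] by measurable
  have m_nonneg: "0 \<le> m r" if "0 \<le> r" for r
    using that L C by (simp add: m_def sd_bound_def)
  have \<kappa>_nonneg: "0 \<le> \<kappa> y" for y by (simp add: \<kappa>_def)
  have w: "x / norm (matrix_inv A *v y) powr (real CARD('n) + 2 * s) = x * \<kappa> y" for x y
  proof -
    have "(a\<^sup>2 * (e \<bullet> y)\<^sup>2 + b\<^sup>2 * (norm (q y))\<^sup>2) powr (real CARD('n) / 2 + s)
        = ((norm (matrix_inv A *v y))\<^sup>2) powr (real CARD('n) / 2 + s)"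
      by (simp add: A_norm q_def)
    also have "(norm (matrix_inv A *v y))\<^sup>2 = norm (matrix_inv A *v y) powr 2"
      by simp
    also have "(norm (matrix_inv A *v y) powr 2) powr (real CARD('n) / 2 + s) = norm (matrix_inv A *v y) powr (real CARD('n) + 2 * s)"
      by (subst powr_powr) (simp add: algebra_simps)
    finally show ?thesis by (simp add: \<kappa>_def)
  qed
  have y_split: "y = (e \<bullet> y) *\<^sub>R e + q y" "S y = (e \<bullet> y) *\<^sub>R e - q y" for y
    by (simp_all add: q_def S_def)
  have norm_y: "(norm y)\<^sup>2 = (e \<bullet> y)\<^sup>2 + (norm (q y))\<^sup>2" for y
    using e unfolding q_def power2_norm_eq_inner
    by (simp add: inner_diff inner_commute power2_eq_square norm_eq_1)
  have S: "orthogonal_transformation S"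
    unfolding S_def[abs_def] q_def[abs_def] by (rule orthogonal_transformation_axis_reflection[OF e])
  have \<kappa>_S: "\<kappa> (S y) = \<kappa> y" for y
  proof -
    have "e \<bullet> q y = 0"
      using e by (simp add: q_def inner_diff_right norm_eq_1)
    then have axis: "e \<bullet> S y = e \<bullet> y"
      using e by (simp add: S_def inner_diff_right norm_eq_1)
    moreover have "q (S y) = - q y"
      unfolding q_def[of "S y"] axis by (simp add: S_def)
    ultimately show ?thesis by (simp add: \<kappa>_def)
  qed
  have \<kappa>_even: "(\<integral>\<^sup>+y. ennreal (h (S y)) * ennreal (\<kappa> y) \<partial>lborel) = (\<integral>\<^sup>+y. ennreal (h y) * ennreal (\<kappa> y) \<partial>lborel)"
    if [measurable]: "h \<in> borel_measurable borel" for h :: "real ^ 'n \<Rightarrow> real"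
    using nn_integral_lborel_orthogonal_transformation[OF S, of "\<lambda>y. ennreal (h y) * ennreal (\<kappa> y)"]
    by (simp add: \<kappa>_S)
  define P where "P = (\<integral>\<^sup>+y. ennreal (\<delta> y) * ennreal (\<kappa> y) \<partial>lborel)"
  define N where "N = (\<integral>\<^sup>+y. ennreal (- \<delta> y) * ennreal (\<kappa> y) \<partial>lborel)"
  define Dp where "Dp = (\<integral>\<^sup>+y. ennreal (d (e \<bullet> y)) * ennreal (\<kappa> y) \<partial>lborel)"
  define Dn where "Dn = (\<integral>\<^sup>+y. ennreal (- d (e \<bullet> y)) * ennreal (\<kappa> y) \<partial>lborel)"
  define M where "M = (\<integral>\<^sup>+y. ennreal (m (norm (q y))) * ennreal (\<kappa> y) \<partial>lborel)"
  have b_eq: "b powr (1 - real CARD('n)) = a"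
  proof -
    have "b powr (real CARD('n) - 1) = b ^ (CARD('n) - 1)"
      using b dim by (subst powr_realpow[symmetric]) (auto simp: of_nat_diff)
    then have "a * b powr (real CARD('n) - 1) = 1" using ab by simp
    moreover have "b powr (1 - real CARD('n)) = 1 / b powr (real CARD('n) - 1)"
      by (metis minus_diff_eq powr_minus_divide)
    ultimately show ?thesis
      using b by (simp add: nonzero_divide_eq_eq del: divide_eq_eq)
  qed
  have c2: "C2_const CARD('n) s * (a powr (- 1 - 2 * s) * b powr (1 - real CARD('n))) = c2"
  proof -
    have "a powr (- 1 - 2 * s) * a = a powr (- 2 * s)"
      using powr_mult_base[of a "- 1 - 2 * s"] a by (simp add: mult.commute)
    then show ?thesis by (simp add: b_eq c2_def)
  qed
  have axial: "(\<integral>\<^sup>+y. ennreal (h (e \<bullet> y)) * ennreal (\<kappa> y) \<partial>lborel)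
      = ennreal c2 * (\<integral>\<^sup>+t. ennreal (h t / \<bar>t\<bar> powr (1 + 2 * s)) \<partial>lborel)"
    if [measurable]: "h \<in> borel_measurable borel" for h
    using nn_integral_kernel_axial[OF dim e a b, of s "\<lambda>t. ennreal (h t)"] s
    by (simp add: c2 \<kappa>_def q_def flip: ennreal_mult'')
  have M: "M = ennreal (2 * C1_const CARD('n) s L C * b powr (- 2 * s) / (1 - s))"
  proof -
    define B where "B = sphere_area (CARD('n) - 1) * (sqrt pi * Gamma ((real CARD('n) - 1) / 2 + s) / Gamma (real CARD('n) / 2 + s))"
    have "b powr (1 - real CARD('n) - 2 * s) / a = b powr (- 2 * s)"
    proof -
      have "b powr (1 - real CARD('n) - 2 * s) = b powr (1 - real CARD('n)) * b powr (- 2 * s)"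
        by (simp add: powr_add[symmetric])
      then show ?thesis using a by (simp add: b_eq)
    qed
    then have "M = ennreal (B * b powr (- 2 * s)) * (\<integral>\<^sup>+r\<in>{0<..}. ennreal (m r) * ennreal (1 / r powr (1 + 2 * s)) \<partial>lborel)"
      using nn_integral_kernel_transversal[OF dim e a b, of s "\<lambda>r. ennreal (m r)"] s
      unfolding M_def \<kappa>_def q_def B_def by simp
    also have "\<dots> = ennreal (B * b powr (- 2 * s)) * (\<integral>\<^sup>+r\<in>{0<..}. ennreal (m r / r powr (1 + 2 * s)) \<partial>lborel)"
      by (simp flip: ennreal_mult'')
    also have "\<dots> = ennreal (B * b powr (- 2 * s) * (mu1 s L C / (1 - s)))"
      unfolding m_def nn_integral_sd_bound_mu1(1)[OF s L(1) C(1)]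
      using nn_integral_sd_bound_mu1(2)[OF s L(1) C(1)] s by (subst ennreal_mult'') auto
    also have "B * b powr (- 2 * s) * (mu1 s L C / (1 - s)) = 2 * C1_const CARD('n) s L C * b powr (- 2 * s) / (1 - s)"
      by (simp add: C1_const_def B_def)
    finally show ?thesis .
  qed
  have fin: "(\<integral>\<^sup>+y. ennreal (m (norm y)) * ennreal (\<kappa> y) \<partial>lborel) < \<infinity>"
  proof -
    have "ennreal (m (norm y)) \<le> 4 * ennreal (m \<bar>e \<bullet> y\<bar>) + 4 * ennreal (m (norm (q y)))" for y
    proof -
      have "m (norm y) \<le> 4 * m \<bar>e \<bullet> y\<bar> + 4 * m (norm (q y))"
        unfolding m_def using L(1) C(1) norm_y[of y] by (intro sd_bound_le_components) auto
      moreover have "4 * ennreal x = ennreal (4 * x)" if "0 \<le> x" for x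
        using that by (subst ennreal_mult) auto
      ultimately show ?thesis
        using m_nonneg by (simp add: ennreal_leI flip: ennreal_plus)
    qed
    then have "(\<integral>\<^sup>+y. ennreal (m (norm y)) * ennreal (\<kappa> y) \<partial>lborel)
      \<le> (\<integral>\<^sup>+y. (4 * ennreal (m \<bar>e \<bullet> y\<bar>) + 4 * ennreal (m (norm (q y)))) * ennreal (\<kappa> y) \<partial>lborel)"
      by (intro nn_integral_mono mult_right_mono) auto
    also have "\<dots> = 4 * (\<integral>\<^sup>+y. ennreal (m \<bar>e \<bullet> y\<bar>) * ennreal (\<kappa> y) \<partial>lborel) + 4 * M"
      unfolding M_def by (simp add: distrib_right nn_integral_add nn_integral_cmult mult.assoc)
    also have "\<dots> < \<infinity>"
      using nn_integral_sd_bound_finite[OF s L(1) C(1)] axial[of "\<lambda>t. m \<bar>t\<bar>"]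
        nn_integral_even[of "\<lambda>t. ennreal (m t / t powr (1 + 2 * s))"]
      by (simp add: M ennreal_mult_less_top) (simp add: m_def ennreal_mult_less_top)
    finally show ?thesis .
  qed
  have "N + ennreal (2 * f 0) \<le> P"
  proof -
    have "(\<integral>\<^sup>+y. ennreal (sd_bound L C (norm y) / norm (matrix_inv A *v y) powr (real CARD('n) + 2 * s)) \<partial>lborel) < \<infinity>"
      using fin by (simp add: w ennreal_mult'' \<kappa>_nonneg m_def)
    from viscosity_imp_integral_inequality[OF visc \<Omega> f L C A this]
    have "(\<integral>\<^sup>+y. ennreal (- (\<delta> y * \<kappa> y)) \<partial>lborel) + ennreal (2 * f 0) \<le> (\<integral>\<^sup>+y. ennreal (\<delta> y * \<kappa> y) \<partial>lborel)"
      unfolding w \<delta>_def .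
    moreover have "ennreal (\<delta> y * \<kappa> y) = ennreal (\<delta> y) * ennreal (\<kappa> y)"
      and "ennreal (- (\<delta> y * \<kappa> y)) = ennreal (- \<delta> y) * ennreal (\<kappa> y)" for y
      using ennreal_mult''[OF \<kappa>_nonneg, of "\<delta> y" y] ennreal_mult''[OF \<kappa>_nonneg, of "- \<delta> y" y] by auto
    ultimately show ?thesis by (simp only: P_def N_def)
  qed
  moreover have "P < \<infinity>"
  proof -
    have "P \<le> (\<integral>\<^sup>+y. ennreal (m (norm y)) * ennreal (\<kappa> y) \<partial>lborel)"
      unfolding P_def using second_difference_le_sd_bound[OF L(2) C(2)]
      by (intro nn_integral_mono mult_right_mono ennreal_leI) (auto simp: \<delta>_def m_def)
    also note fin
    finally show ?thesis .
  qed
  moreover have "2 * Dn + (P + P) \<le> 2 * Dp + 2 * M + (N + N)"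
  proof -
    have ineq: "2 * ennreal (- d (e \<bullet> y)) + (ennreal (\<delta> y) + ennreal (\<delta> (S y)))
      \<le> 2 * ennreal (d (e \<bullet> y)) + 2 * ennreal (m (norm (q y))) + (ennreal (- \<delta> y) + ennreal (- \<delta> (S y)))" for y
    proof -
      have "\<delta> y + \<delta> (S y) \<le> 2 * d (e \<bullet> y) + 2 * m (norm (q y))"
        using second_difference_add_reflection_le[OF L(2) C(2), of "(e \<bullet> y) *\<^sub>R e" "q y"]
        by (simp add: \<delta>_def d_def m_def y_split[symmetric])
      then have real_ineq: "2 * max 0 (- d (e \<bullet> y)) + (max 0 (\<delta> y) + max 0 (\<delta> (S y)))
        \<le> 2 * max 0 (d (e \<bullet> y)) + 2 * m (norm (q y)) + (max 0 (- \<delta> y) + max 0 (- \<delta> (S y)))"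
        by (simp add: max_def)
      have pos: "ennreal x = ennreal (max 0 x)" for x by (simp add: max_def ennreal_neg)
      have two: "2 * ennreal x = ennreal (2 * x)" if "0 \<le> x" for x
        using that by (subst ennreal_mult) auto
      show ?thesis
        using ennreal_leI[OF real_ineq] m_nonneg[of "norm (q y)"]
        by (simp add: two[symmetric] pos[symmetric])
    qed
    have "2 * Dn + (P + P) = 2 * Dn + (P + (\<integral>\<^sup>+y. ennreal (\<delta> (S y)) * ennreal (\<kappa> y) \<partial>lborel))"
      unfolding P_def by (subst \<kappa>_even) auto
    also have "\<dots> = (\<integral>\<^sup>+y. (2 * ennreal (- d (e \<bullet> y)) + (ennreal (\<delta> y) + ennreal (\<delta> (S y)))) * ennreal (\<kappa> y) \<partial>lborel)"
      unfolding Dn_def P_def by (simp add: distrib_right nn_integral_add nn_integral_cmult mult.assoc)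
    also have "\<dots> \<le> (\<integral>\<^sup>+y. (2 * ennreal (d (e \<bullet> y)) + 2 * ennreal (m (norm (q y))) + (ennreal (- \<delta> y) + ennreal (- \<delta> (S y)))) * ennreal (\<kappa> y) \<partial>lborel)"
      using ineq by (intro nn_integral_mono mult_right_mono) auto
    also have "\<dots> = 2 * Dp + 2 * M + (N + (\<integral>\<^sup>+y. ennreal (- \<delta> (S y)) * ennreal (\<kappa> y) \<partial>lborel))"
      unfolding Dp_def M_def N_def by (simp add: distrib_right nn_integral_add nn_integral_cmult mult.assoc)
    also have "(\<integral>\<^sup>+y. ennreal (- \<delta> (S y)) * ennreal (\<kappa> y) \<partial>lborel) = N"
      unfolding N_def by (rule \<kappa>_even[of "\<lambda>y. - \<delta> y"]) measurable
    finally show ?thesis .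
  qed
  ultimately have key: "Dn + ennreal (2 * f 0) \<le> Dp + M"
    by (rule ennreal_cancel_doubled)
  have "Dp = ennreal c2 * (\<integral>\<^sup>+t. ennreal (g t) \<partial>lborel)"
    unfolding Dp_def g_def d_def[symmetric] by (rule axial) measurable
  moreover have "Dn = ennreal c2 * (\<integral>\<^sup>+t. ennreal (- g t) \<partial>lborel)"
    unfolding Dn_def g_def d_def[symmetric] minus_divide_left by (rule axial) measurable
  ultimately show ?thesis using key M by simp
qed

section \<open>The two-sided bound\<close>

theorem proposition3p3:
  fixes u :: "real ^ 'n \<Rightarrow> real" and \<Omega> :: "(real ^ 'n) set" and e :: "real ^ 'n"
    and s L C \<eta>\<^sub>0 :: real
  assumes "CARD('n) \<ge> 2"
    and "1 / 2 < s" and "s < 1"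
    and "open \<Omega>" and "0 \<in> \<Omega>"
    and "L > 0" and "L-lipschitz_on UNIV u"
    and "C > 0" and "semiconcave C u"
    and "\<eta>\<^sub>0 > 0" and "viscosity_nonlocal_MA_ge s \<Omega> u (\<lambda>x. \<eta>\<^sub>0 / (1 - s))"
    and "norm e = 1"
  shows "0 < mu0 CARD('n) s L C \<eta>\<^sub>0 \<and>
    mu0 CARD('n) s L C \<eta>\<^sub>0 \<le> - ((1 - s) * frac_laplacian_dir s e u 0) \<and>
    - ((1 - s) * frac_laplacian_dir s e u 0) =
      (1 - s) * pv_integral (\<lambda>t. (u (t *\<^sub>R e) - u 0) / \<bar>t\<bar> powr (1 + 2 * s)) \<and>
    (1 - s) * pv_integral (\<lambda>t. (u (t *\<^sub>R e) - u 0) / \<bar>t\<bar> powr (1 + 2 * s)) \<le> mu1 s L C"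
proof -
  note s = \<open>1 / 2 < s\<close> \<open>s < 1\<close>
  note dim = \<open>CARD('n) \<ge> 2\<close> and L = \<open>L > 0\<close> \<open>L-lipschitz_on UNIV u\<close>
    and C = \<open>C > 0\<close> \<open>semiconcave C u\<close> and \<eta> = \<open>\<eta>\<^sub>0 > 0\<close> and e = \<open>norm e = 1\<close>
  let ?n = "CARD('n)"
  define g where "g t = second_difference u 0 (t *\<^sub>R e) / \<bar>t\<bar> powr (1 + 2 * s)" for t
  define bound where "bound t = sd_bound L C \<bar>t\<bar> / \<bar>t\<bar> powr (1 + 2 * s)" for t
  have "continuous_on UNIV u" using C(2) by (simp add: semiconcave_def)
  then have [measurable]: "u \<in> borel_measurable borel"
    by (rule borel_measurable_continuous_onI)
  have g_meas [measurable]: "g \<in> borel_measurable borel"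
    unfolding g_def[abs_def] second_difference_def by measurable
  have g_le: "g t \<le> bound t" for t
    using second_difference_le_sd_bound[OF L(2) C(2), of 0 "t *\<^sub>R e"] e
    by (simp add: g_def bound_def divide_right_mono)
  have mu1: "0 < mu1 s L C" and bound_int: "integrable lborel bound"
    using nn_integral_sd_bound_mu1(2,3)[OF s L(1) C(1)] by (simp_all add: bound_def[abs_def])
  have omega: "0 < sphere_area (?n - 1)"
    using dim by (simp add: sphere_area_def Gamma_real_pos)
  have "0 < Gamma ((real ?n - 1) / 2 + s)" "0 < Gamma (real ?n / 2 + s)"
    "0 < Gamma ((real ?n - 1) / 2)" "0 < Gamma (s + 1 / 2)"
    using dim s by (auto intro!: Gamma_real_pos add_pos_pos)
  then have C1: "0 < C1_const ?n s L C" and C2: "0 < C2_const ?n s"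
    using omega mu1 by (simp_all add: C1_const_def C2_const_def)
  \<comment> \<open>Chosen so that the error term of the reflection argument uses up half of \<open>2 * \<eta>\<^sub>0 / (1 - s)\<close>; \<open>a\<close> follows from the determinant.\<close>
  define b where "b = (\<eta>\<^sub>0 / (2 * C1_const ?n s L C)) powr (- 1 / (2 * s))"
  define a where "a = 1 / b ^ (?n - 1)"
  have b: "0 < b" using \<eta> C1 by (simp add: b_def)
  have a: "0 < a" "a * b ^ (?n - 1) = 1" using b by (simp_all add: a_def)
  have b_powr: "b powr (- 2 * s) = \<eta>\<^sub>0 / (2 * C1_const ?n s L C)"
    using s \<eta> C1 by (simp add: b_def powr_powr)
  define c where "c = C2_const ?n s * a powr (- 2 * s)"
  have c: "0 < c" using C2 a by (simp add: c_def)
  define P where "P = (\<integral>\<^sup>+t. ennreal (g t) \<partial>lborel)"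
  define N where "N = (\<integral>\<^sup>+t. ennreal (- g t) \<partial>lborel)"
  have "0 \<le> \<eta>\<^sub>0 / (1 - s)" using \<eta> s by simp
  note axial = viscosity_imp_axial_inequality[OF dim s assms(11,4,5) this L C e a(1) b a(2)]
  have error: "2 * C1_const ?n s L C * b powr (- 2 * s) / (1 - s) = \<eta>\<^sub>0 / (1 - s)"
    unfolding b_powr using C1 by simp
  have main: "ennreal c * N + ennreal (2 * (\<eta>\<^sub>0 / (1 - s))) \<le> ennreal c * P + ennreal (\<eta>\<^sub>0 / (1 - s))"
    using axial unfolding error P_def N_def g_def c_def .
  have "P < \<infinity>"
  proof -
    have "P \<le> (\<integral>\<^sup>+t. ennreal (bound t) \<partial>lborel)"
      unfolding P_def using g_le by (intro nn_integral_mono ennreal_leI) auto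
    also have "\<dots> < \<infinity>"
      using bound_int by (simp add: real_integrable_def less_top)
    finally show ?thesis .
  qed
  then obtain p where p: "P = ennreal p" "0 \<le> p" by (cases P) auto
  have "N < \<infinity>"
  proof (rule ccontr)
    \<comment> \<open>The integrability of the second difference along \<open>e\<close>: an infinite left-hand side would contradict the finite right-hand side.\<close>
    assume "\<not> N < \<infinity>"
    then have "N = top" by (simp add: less_top[symmetric])
    then show False using main p c by (simp add: ennreal_mult_top top_unique ennreal_mult[symmetric])
  qed
  then obtain q where q: "N = ennreal q" "0 \<le> q" by (cases N) auto
  have g_int: "integrable lborel g"
    using p q by (auto simp: real_integrable_def P_def N_def)
  have "(LINT t|lborel. g t) = p - q"
    using p q by (subst real_lebesgue_integral_def[OF g_int]) (auto simp: P_def N_def)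
  moreover have "c * q + 2 * (\<eta>\<^sub>0 / (1 - s)) \<le> c * p + \<eta>\<^sub>0 / (1 - s)"
    using main p q c \<eta> s
    by (simp add: ennreal_mult[symmetric] ennreal_plus[symmetric] del: ennreal_plus)
  ultimately have "\<eta>\<^sub>0 / (1 - s) \<le> c * (LINT t|lborel. g t)"
    by (simp add: right_diff_distrib)
  then have lower: "\<eta>\<^sub>0 / 2 / c \<le> (1 - s) * (1 / 2 * (LINT t|lborel. g t))"
    using c s by (simp add: field_simps)
  have mu0: "mu0 ?n s L C \<eta>\<^sub>0 = \<eta>\<^sub>0 / 2 / c"
  proof -
    have "a powr (- 2 * s) = (b powr (- 2 * s)) powr (- (real ?n - 1))"
    proof -
      have "a = b powr (- (real ?n - 1))"
        unfolding powr_minus_divide a_def using b dim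
        by (subst powr_realpow[symmetric]) (auto simp: of_nat_diff)
      then show ?thesis by (simp add: powr_powr mult.commute)
    qed
    also have "\<dots> = 1 / (\<eta>\<^sub>0 / (2 * C1_const ?n s L C)) ^ (?n - 1)"
      unfolding powr_minus_divide b_powr using \<eta> C1 dim
      by (subst powr_realpow[symmetric]) (auto simp: of_nat_diff)
    finally have a_powr: "a powr (- 2 * s) = 1 / (\<eta>\<^sub>0 / (2 * C1_const ?n s L C)) ^ (?n - 1)" .
    have "1 - int ?n = - int (?n - 1)" using dim by (simp add: of_nat_diff)
    then have "C1_const ?n s L C powi (1 - int ?n) = 1 / C1_const ?n s L C ^ (?n - 1)"
      by (simp only: power_int_minus power_int_of_nat inverse_eq_divide)
    moreover have "(\<eta>\<^sub>0 / 2) ^ ?n = \<eta>\<^sub>0 / 2 * (\<eta>\<^sub>0 / 2) ^ (?n - 1)"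
      using dim by (simp flip: power_Suc)
    moreover have "(\<eta>\<^sub>0 / (2 * C1_const ?n s L C)) ^ (?n - 1) = (\<eta>\<^sub>0 / 2) ^ (?n - 1) / C1_const ?n s L C ^ (?n - 1)"
      by (simp add: power_divide[symmetric])
    ultimately show ?thesis
      unfolding mu0_def c_def a_powr using C1 C2 \<eta> by (simp add: field_simps)
  qed
  have mu1_eq: "mu1 s L C = (1 - s) * (1 / 2 * (LINT t|lborel. bound t))"
    by (simp add: mu1_def bound_def[abs_def] sd_bound_def)
  have frac: "- ((1 - s) * frac_laplacian_dir s e u 0) = (1 - s) * (1 / 2 * (LINT t|lborel. g t))"
    by (simp add: frac_laplacian_dir_def g_def)
  have pv: "pv_integral (\<lambda>t. (u (t *\<^sub>R e) - u 0) / \<bar>t\<bar> powr (1 + 2 * s)) = 1 / 2 * (LINT t|lborel. g t)"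
    unfolding pv_integral_def g_def[abs_def]
    by (simp add: second_difference_def add_divide_distrib[symmetric])
  have "(LINT t|lborel. g t) \<le> (LINT t|lborel. bound t)"
    using g_le by (intro integral_mono g_int bound_int)
  then have "(1 - s) * (1 / 2 * (LINT t|lborel. g t)) \<le> mu1 s L C"
    unfolding mu1_eq using s by (intro mult_left_mono) auto
  then show ?thesis
    using lower \<eta> c by (simp add: mu0 frac pv)
qed

end
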